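(* Let $p\in\mathbb{C}\setminus\{0\}$ and let $M$ be a nontrivial finite irreducible conformal module over $\mathcal{B}(p)$. (1) If $p\neq-1$, then $M\cong M_{\Delta,\alpha}$ for some $\Delta,\alpha\in\mathbb{C}$ with $\Delta\neq0$. (2) If $p=-1$, then $M\cong M_{\Delta,\alpha,\beta}$ for some $\Delta,\alpha,\beta\in\mathbb{C}$ with $\Delta\neq0$ or $\beta\neq0$.
   Context: $\mathcal{B}(p)$ ($p\in\mathbb{C}$, $p\neq0$) is the Lie conformal algebra which is a free $\mathbb{C}[\partial]$-module with basis $\{L_i\mid i\in\mathbb{Z}_+\}$ ($\mathbb{Z}_+=\{0,1,2,\dots\}$) and $\lambda$-brackets $[L_i\,{}_\lambda\,L_j]=((i+p)\partial+(i+j+2p)\lambda)L_{i+j}$. A conformal module over $\mathcal{B}(p)$ is a $\mathbb{C}[\partial]$-module $M$ with a $\mathbb{C}$-linear $\lambda$-action $\mathcal{B}(p)\otimes M\to\mathbb{C}[\lambda]\otimes M$, $a\otimes v\mapsto a\,{}_\lambda\,v$, with $(\partial a)\,{}_\lambda\,v=-\lambda a\,{}_\lambda\,v$, $a\,{}_\lambda\,(\partial v)=(\partial+\lambda)a\,{}_\lambda\,v$, $[a\,{}_\lambda\,b]\,{}_{\lambda+\mu}\,v=a\,{}_\lambda\,(b\,{}_\mu\,v)-b\,{}_\mu\,(a\,{}_\lambda\,v)$. It is finite if finitely generated over $\mathbb{C}[\partial]$, irreducible if it has no nonzero proper conformal submodules ($\mathbb{C}[\partial]$-submodules stable under the $\lambda$-action),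 and nontrivial if the $\lambda$-action is not identically zero. For $\Delta,\alpha\in\mathbb{C}$, $M_{\Delta,\alpha}=\mathbb{C}[\partial]v$ (free of rank one) is the conformal $\mathcal{B}(p)$-module with $L_0\,{}_\lambda\,v=p(\partial+\Delta\lambda+\alpha)v$ and $L_i\,{}_\lambda\,v=0$ for $i\ge1$. For $p=-1$ and $\Delta,\alpha,\beta\in\mathbb{C}$, $M_{\Delta,\alpha,\beta}=\mathbb{C}[\partial]v$ is the conformal $\mathcal{B}(-1)$-module with $L_0\,{}_\lambda\,v=-(\partial+\Delta\lambda+\alpha)v$, $L_1\,{}_\lambda\,v=\beta v$, and $L_i\,{}_\lambda\,v=0$ for $i\ge2$. *)

theory Defs
  imports Complex_Main "HOL-Computational_Algebra.Polynomial"
begin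

text \<open>
  A conformal module over B(p) is encoded by a triple (sc, D, act) on a type 'm:
  sc is the complex scalar multiplication (M is a complex vector space),
  D is the action of \<partial> (a C-linear endomorphism, making M a C[\<partial>]-module),
  and act i v :: 'm poly is L_i _\<lambda> v, a polynomial in \<lambda> with coefficients in M.
  Since B(p) is a free C[\<partial>]-module with basis L_i, the relation
  (\<partial>a)_\<lambda> v = - \<lambda> a_\<lambda> v determines the action of all of B(p) from the
  action of the L_i.
\<close>

definition peval :: "(complex \<Rightarrow> 'm \<Rightarrow> 'm) \<Rightarrow> ('m::ab_group_add) poly \<Rightarrow> complex \<Rightarrow> 'm" where
  "peval sc P z = (\<Sum>k\<le>degree P. sc (z ^ k) (coeff P k))"

definition polyD :: "(complex \<Rightarrow> 'm \<Rightarrow> 'm) \<Rightarrow> ('m \<Rightarrow> 'm) \<Rightarrow> complex poly \<Rightarrow> 'm::ab_group_add \<Rightarrow> 'm" where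
  "polyD sc D f m = (\<Sum>k\<le>degree f. sc (coeff f k) ((D ^^ k) m))"

definition conformal_module ::
  "complex \<Rightarrow> (complex \<Rightarrow> 'm::ab_group_add \<Rightarrow> 'm) \<Rightarrow> ('m \<Rightarrow> 'm) \<Rightarrow> (nat \<Rightarrow> 'm \<Rightarrow> 'm poly) \<Rightarrow> bool" where
  "conformal_module p sc D act \<longleftrightarrow>
     vector_space sc \<and>
     Vector_Spaces.linear sc sc D \<and>
     (\<forall>i k. Vector_Spaces.linear sc sc (\<lambda>v. coeff (act i v) k)) \<and>
     \<comment> \<open>a_\<lambda> (\<partial> v) = (\<partial> + \<lambda>) a_\<lambda> v\<close>
     (\<forall>i v k. coeff (act i (D v)) k =
                D (coeff (act i v) k) + (if k = 0 then 0 else coeff (act i v) (k - 1))) \<and>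
     \<comment> \<open>[L_i _\<lambda> L_j]_{\<lambda>+\<mu>} v = L_i _\<lambda> (L_j _\<mu> v) - L_j _\<mu> (L_i _\<lambda> v), where
         [L_i _\<lambda> L_j] = ((i+p)\<partial> + (i+j+2p)\<lambda>) L_{i+j} and (\<partial>a)_{\<lambda>+\<mu>} = -(\<lambda>+\<mu>) a_{\<lambda>+\<mu>}\<close>
     (\<forall>i j v (l::complex) (m::complex).
        sc ((of_nat i + p) * (- (l + m)) + (of_nat i + of_nat j + 2 * p) * l)
           (peval sc (act (i + j) v) (l + m))
        = (\<Sum>b\<le>degree (act j v). sc (m ^ b) (peval sc (act i (coeff (act j v) b)) l))
          - (\<Sum>a\<le>degree (act i v). sc (l ^ a) (peval sc (act j (coeff (act i v) a)) m)))"

definition conf_submodule ::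
  "(complex \<Rightarrow> 'm \<Rightarrow> 'm) \<Rightarrow> ('m \<Rightarrow> 'm) \<Rightarrow> (nat \<Rightarrow> 'm \<Rightarrow> 'm::ab_group_add poly) \<Rightarrow> 'm set \<Rightarrow> bool" where
  "conf_submodule sc D act N \<longleftrightarrow>
     module.subspace sc N \<and> (\<forall>v\<in>N. D v \<in> N) \<and> (\<forall>v\<in>N. \<forall>i k. coeff (act i v) k \<in> N)"

definition finite_conf ::
  "(complex \<Rightarrow> 'm::ab_group_add \<Rightarrow> 'm) \<Rightarrow> ('m \<Rightarrow> 'm) \<Rightarrow> bool" where
  "finite_conf sc D \<longleftrightarrow>
     (\<exists>S::'m set. finite S \<and> (\<forall>x. \<exists>f. x = (\<Sum>s\<in>S. polyD sc D (f s) s)))"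

definition irreducible_conf ::
  "(complex \<Rightarrow> 'm \<Rightarrow> 'm) \<Rightarrow> ('m \<Rightarrow> 'm) \<Rightarrow> (nat \<Rightarrow> 'm \<Rightarrow> 'm::ab_group_add poly) \<Rightarrow> bool" where
  "irreducible_conf sc D act \<longleftrightarrow>
     (\<exists>x::'m. x \<noteq> 0) \<and>
     (\<forall>N. conf_submodule sc D act N \<longrightarrow> N = {0} \<or> N = UNIV)"

definition nontrivial_conf :: "(nat \<Rightarrow> 'm \<Rightarrow> 'm::zero poly) \<Rightarrow> bool" where
  "nontrivial_conf act \<longleftrightarrow> (\<exists>i v. act i v \<noteq> 0)"

definition conf_iso ::
  "(complex \<Rightarrow> 'm \<Rightarrow> 'm) \<Rightarrow> ('m \<Rightarrow> 'm) \<Rightarrow> (nat \<Rightarrow> 'm \<Rightarrow> 'm::ab_group_add poly) \<Rightarrow>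
   (complex \<Rightarrow> 'n \<Rightarrow> 'n) \<Rightarrow> ('n \<Rightarrow> 'n) \<Rightarrow> (nat \<Rightarrow> 'n \<Rightarrow> 'n::ab_group_add poly) \<Rightarrow> bool" where
  "conf_iso sc1 D1 act1 sc2 D2 act2 \<longleftrightarrow>
     (\<exists>\<phi>. bij \<phi> \<and> Vector_Spaces.linear sc1 sc2 \<phi> \<and> (\<forall>v. \<phi> (D1 v) = D2 (\<phi> v)) \<and>
          (\<forall>i v k. coeff (act2 i (\<phi> v)) k = \<phi> (coeff (act1 i v) k)))"

text \<open>Rank one free modules C[\<partial>]v, modelled on complex poly (f \<leftrightarrow> f(\<partial>) v).
  Elements of C[\<lambda>] \<otimes> C[\<partial>] are complex poly poly (outer variable \<lambda>).
  shift f = f(\<partial> + \<lambda>).\<close>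

definition shift :: "complex poly \<Rightarrow> complex poly poly" where
  "shift f = poly (map_poly (\<lambda>c. [:[:c:]:]) f) [:[:0, 1:], 1:]"

definition rk1_D :: "complex poly \<Rightarrow> complex poly" where
  "rk1_D f = [:0, 1:] * f"

text \<open>M_{\<Delta>,\<alpha>}: L_0 _\<lambda> v = p(\<partial> + \<Delta>\<lambda> + \<alpha>) v, L_i _\<lambda> v = 0 (i \<ge> 1);
  hence L_0 _\<lambda> (f(\<partial>)v) = f(\<partial>+\<lambda>) p(\<partial> + \<Delta>\<lambda> + \<alpha>) v.\<close>
definition M_act :: "complex \<Rightarrow> complex \<Rightarrow> complex \<Rightarrow> nat \<Rightarrow> complex poly \<Rightarrow> complex poly poly" where
  "M_act p \<Delta> \<alpha> i f =
     (if i = 0 then shift f * [: [:p * \<alpha>, p:], [:p * \<Delta>:] :] else 0)"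

text \<open>M_{\<Delta>,\<alpha>,\<beta>} for p = -1: L_0 _\<lambda> v = -(\<partial> + \<Delta>\<lambda> + \<alpha>) v, L_1 _\<lambda> v = \<beta> v,
  L_i _\<lambda> v = 0 (i \<ge> 2).\<close>
definition M3_act :: "complex \<Rightarrow> complex \<Rightarrow> complex \<Rightarrow> nat \<Rightarrow> complex poly \<Rightarrow> complex poly poly" where
  "M3_act \<Delta> \<alpha> \<beta> i f =
     (if i = 0 then shift f * [: [:- \<alpha>, -1:], [:- \<Delta>:] :]
      else if i = 1 then shift f * [:[:\<beta>:]:] else 0)"

end

(*
  Write L_i v = sum_n X i n v lambda^n / n!. The operators X i n satisfy Block-type commutation
  relations, D - X 0 0 / p commutes with all of them and hence is a scalar, and X 0 1 / p is a
  grading operator (Euler operator) on M. If a finite C[D]-module has no vector killed by L_i,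
  the vectors killed by all X i k with k >= n form a finite-dimensional space, which supplies
  eigenvectors.

  A generator of lowest weight is singular for the Virasoro part. For large j it is killed by L_j:
  modulo a flag of Virasoro submodules with rank one quotients, the top degree of a nonzero X j 0
  satisfies a quadratic equation. So only finitely many L_j act nontrivially. For the largest such
  j >= 1 the operators X j n commute; a common eigenvector together with Heisenberg-type
  commutators on finite-dimensional spaces forces p = -j and X j 0 scalar, and then j = 1. What
  remains is a module generated over C[D] by the lowest weight vector.
*)
theory Submission
  imports Defs "HOL-Computational_Algebra.Fundamental_Theorem_Algebra"
begin

section \<open>Linear algebra\<close>

text \<open>The factor n! turns sesquilinearity into the Leibniz-type rule \<open>X_D\<close> and
  makes the bracket coefficients m (j + p) - n (i + p) bilinear in modes and indices. No grading of
  M by the index i is given, so weight arguments rest on the Euler operator, for which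
  \<open>X j n\<close> has degree j/p + 1 - n. Weights are therefore complex, and only their real
  parts turn out to be bounded below. If Re (1/p) < 0, degree alone makes L_j kill a lowest weight
  vector for large j. If Re (1/p) > 0, the operators \<open>X j 0\<close> raise weights without
  bound and degree says nothing; the quadratic equation on the flag replaces it and works for every
  p. Once a largest index j >= 1 exists, brackets of two of its modes have index 2 j and vanish,
  which is what makes finite-dimensional linear algebra available.\<close>

locale complex_space = vector_space sc
  for sc :: "complex \<Rightarrow> 'm::ab_group_add \<Rightarrow> 'm" (infixr "*s" 75)
begin

abbreviation lin :: "('m \<Rightarrow> 'm) \<Rightarrow> bool"
  where "lin T \<equiv> Vector_Spaces.linear sc sc T"

definition fdim :: "'m set \<Rightarrow> bool"
  where "fdim V \<longleftrightarrow> (\<exists>B. finite B \<and> V \<subseteq> span B)"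

lemma linI:
  assumes "\<And>x y. T (x + y) = T x + T y" "\<And>c x. T (c *s x) = c *s T x"
  shows "lin T"
  using assms vector_space_axioms by (simp add: Vector_Spaces.linear_iff)

lemma lin_hom: "lin T \<Longrightarrow> module_hom sc sc T"
  by (simp add: module_hom_iff_linear)

lemmas lin_add = module_hom.add[OF lin_hom]
  and lin_scale = module_hom.scale[OF lin_hom]
  and lin_zero = module_hom.zero[OF lin_hom]
  and lin_neg = module_hom.neg[OF lin_hom]
  and lin_diff = module_hom.diff[OF lin_hom]
  and lin_sum = module_hom.sum[OF lin_hom]
  and lin_span_image = module_hom.span_image[OF lin_hom]

lemmas lin_simps = lin_add lin_scale lin_zero lin_neg lin_diff

lemma lin_funpow: "lin T \<Longrightarrow> lin (T ^^ n)"
  by (induction n) (auto intro!: linI simp: lin_simps)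

lemma fdim_subset: "fdim V \<Longrightarrow> W \<subseteq> V \<Longrightarrow> fdim W"
  unfolding fdim_def by blast

lemma fdim_zero: "fdim {0}"
  unfolding fdim_def by (rule exI[of _ "{}"]) auto

lemma span_stable:
  assumes "lin T" "\<And>s. s \<in> S \<Longrightarrow> T s \<in> span S" "x \<in> span S"
  shows "T x \<in> span S"
proof -
  have "T x \<in> T ` span S" using assms(3) by blast
  also have "\<dots> = span (T ` S)" using lin_span_image[OF assms(1)] by simp
  also have "\<dots> \<subseteq> span S" using assms(2) by (intro span_minimal) auto
  finally show ?thesis .
qed

text \<open>Rank-nullity without dimensions: preimages of a basis of the image, together with
  vectors spanning the kernel, span V.\<close>

lemma fdim_kernel_image:
  assumes T: "lin T" and V: "subspace V" and im: "fdim (T ` V)"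
    and ker: "fdim {v \<in> V. T v = 0}"
  shows "fdim V"
proof -
  obtain U where U: "finite U" "T ` V \<subseteq> span U" using im fdim_def by blast
  obtain K where K: "finite K" "{v \<in> V. T v = 0} \<subseteq> span K" using ker fdim_def by blast
  obtain B where B: "B \<subseteq> T ` V" "independent B" "T ` V \<subseteq> span B"
    using basis_exists by metis
  have finB: "finite B" using independent_span_bound[OF U(1) B(2)] B(1) U(2) by blast
  obtain C where C: "C \<subseteq> V" "finite C" "B = T ` C"
    using finite_subset_image[OF finB B(1)] by blast
  have "V \<subseteq> span (K \<union> C)"
  proof
    fix v assume v: "v \<in> V"
    then have "T v \<in> span (T ` C)" using B(3) C(3) by blast
    then obtain c where c: "c \<in> span C" "T v = T c"
      using lin_span_image[OF T] by auto
    have "c \<in> V" using c(1) span_minimal[OF C(1) V] by blast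
    then have "v - c \<in> {v \<in> V. T v = 0}"
      using v c(2) V T by (simp add: lin_diff subspace_diff)
    then have "v - c \<in> span (K \<union> C)"
      using K(2) span_mono[of K "K \<union> C"] by blast
    moreover have "c \<in> span (K \<union> C)" using c(1) span_mono[of C "K \<union> C"] by blast
    ultimately show "v \<in> span (K \<union> C)" using span_add by fastforce
  qed
  then show ?thesis unfolding fdim_def using K(1) C(2) by blast
qed

text \<open>Sequences rather than sets: a repetition is already a relation, and an injective
  sequence has an infinite range inside a finite span.\<close>

lemma fdim_dependent_seq:
  fixes x :: "nat \<Rightarrow> 'm"
  assumes "fdim V" "\<And>k. x k \<in> V"
  obtains n c where "(\<Sum>k\<le>n. c k *s x k) = 0" "\<exists>k\<le>n. c k \<noteq> (0::complex)"
proof (cases "inj x")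
  case False
  then obtain i j where ij: "i < j" "x i = x j"
    unfolding inj_def by (metis linorder_neqE_nat)
  define c where "c k = (if k = i then 1 else if k = j then - 1 else 0 :: complex)" for k
  have "(\<Sum>k\<le>j. c k *s x k) = (\<Sum>k\<in>{i,j}. c k *s x k)"
    using ij by (intro sum.mono_neutral_right) (auto simp: c_def)
  also have "\<dots> = 0" using ij by (auto simp: c_def)
  finally have "(\<Sum>k\<le>j. c k *s x k) = 0" .
  moreover have "\<exists>k\<le>j. c k \<noteq> 0" using ij by (intro exI[of _ i]) (auto simp: c_def)
  ultimately show ?thesis using that by blast
next
  case True
  obtain B where B: "finite B" "V \<subseteq> span B" using assms fdim_def by blast
  have "infinite (range x)" using True finite_imageD by blast
  then have "dependent (range x)"
    using independent_span_bound[OF B(1), of "range x"] B(2) assms(2) by blast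
  then obtain t u where tu: "finite t" "t \<subseteq> range x" "(\<Sum>v\<in>t. u v *s v) = 0"
    "\<exists>v\<in>t. u v \<noteq> 0" unfolding dependent_explicit by blast
  obtain I where I: "finite I" "t = x ` I" using finite_subset_image[OF tu(1,2)] by blast
  obtain n where n: "I \<subseteq> {..n}" using I(1) finite_nat_iff_bounded_le by blast
  define c where "c k = (if k \<in> I then u (x k) else 0)" for k
  have "(\<Sum>k\<le>n. c k *s x k) = (\<Sum>k\<in>I. u (x k) *s x k)"
    using n by (intro sum.mono_neutral_cong_right) (auto simp: c_def)
  also have "\<dots> = (\<Sum>v\<in>t. u v *s v)"
    unfolding I(2) using True by (subst sum.reindex) (auto simp: inj_on_def inj_def)
  finally have "(\<Sum>k\<le>n. c k *s x k) = 0" using tu(3) by simp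
  moreover have "\<exists>k\<le>n. c k \<noteq> 0" using tu(4) I(2) n by (auto simp: c_def)
  ultimately show ?thesis using that by blast
qed

section \<open>Polynomials in an operator, and eigenvectors\<close>

lemma polyD_eq:
  assumes "degree f \<le> n"
  shows "polyD sc T f v = (\<Sum>k\<le>n. coeff f k *s (T ^^ k) v)"
  unfolding polyD_def using assms
  by (intro sum.mono_neutral_left) (auto simp: coeff_eq_0)

lemma polyD_0 [simp]: "polyD sc T 0 v = 0"
  by (simp add: polyD_def)

lemma polyD_const [simp]: "polyD sc T [:a:] v = a *s v"
  by (simp add: polyD_def)

lemma polyD_add: "polyD sc T (f + g) v = polyD sc T f v + polyD sc T g v"
proof -
  let ?n = "max (degree f) (degree g)"
  have "degree (f + g) \<le> ?n" by (rule degree_add_le) auto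
  then show ?thesis
    by (simp add: polyD_eq[where n = ?n] scale_left_distrib sum.distrib)
qed

lemma polyD_smult: "polyD sc T (smult a f) v = a *s polyD sc T f v"
  using degree_smult_le[of a f]
  by (simp add: polyD_eq[where n = "degree f"] scale_sum_right)

lemma polyD_pCons:
  assumes "lin T"
  shows "polyD sc T (pCons a f) v = a *s v + T (polyD sc T f v)"
proof -
  have "polyD sc T (pCons a f) v = (\<Sum>k\<le>Suc (degree f). coeff (pCons a f) k *s (T ^^ k) v)"
    by (intro polyD_eq) (simp add: degree_pCons_le)
  also have "\<dots> = a *s v + (\<Sum>k\<le>degree f. coeff f k *s T ((T ^^ k) v))"
    by (subst sum.atMost_Suc_shift) simp
  also have "(\<Sum>k\<le>degree f. coeff f k *s T ((T ^^ k) v)) = T (polyD sc T f v)"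
    unfolding polyD_def using assms by (simp add: lin_sum lin_scale)
  finally show ?thesis .
qed

lemma polyD_mult:
  assumes "lin T"
  shows "polyD sc T (f * g) v = polyD sc T f (polyD sc T g v)"
  by (induction f) (simp_all add: assms polyD_pCons polyD_add polyD_smult lin_simps)

lemma polyD_in:
  assumes "lin T" "subspace V" "\<And>v. v \<in> V \<Longrightarrow> T v \<in> V" "v \<in> V"
  shows "polyD sc T f v \<in> V"
  by (induction f) (auto simp: assms polyD_pCons subspace_add subspace_scale subspace_0)

text \<open>Split off a root, f = (T - c) g. Either g(T) v is an eigenvector for c, or g is an
  annihilator of smaller degree.\<close>

lemma eigenvector_of_annihilator:
  assumes "lin T" "subspace V" "\<And>v. v \<in> V \<Longrightarrow> T v \<in> V" "v \<in> V" "v \<noteq> 0"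
    "f \<noteq> 0" "polyD sc T f v = 0"
  shows "\<exists>u\<in>V. u \<noteq> 0 \<and> (\<exists>c. T u = c *s u)"
  using assms(6,7)
proof (induction "degree f" arbitrary: f rule: less_induct)
  case less
  show ?case
  proof (cases "degree f = 0")
    case True
    then obtain a where "f = [:a:]" by (rule degree_eq_zeroE)
    then show ?thesis using less.prems assms(5) by simp
  next
    case False
    then obtain c where "poly f c = 0"
      using fundamental_theorem_of_algebra constant_degree by metis
    then obtain g where g: "f = [:-c, 1:] * g" by (auto simp: poly_eq_0_iff_dvd)
    then have g0: "g \<noteq> 0" using less.prems by auto
    then have deg: "degree g < degree f" unfolding g by (subst degree_mult_eq) auto
    let ?w = "polyD sc T g v"
    have "T ?w = c *s ?w"
      using less.prems(2) assms(1) unfolding g polyD_mult[OF assms(1)]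
      by (simp add: polyD_pCons lin_simps)
    moreover have "?w \<in> V" using assms by (intro polyD_in) auto
    ultimately show ?thesis using less.hyps[OF deg g0] by blast
  qed
qed

lemma fdim_eigenvector:
  assumes "fdim V" "lin T" "subspace V" "T ` V \<subseteq> V" "v \<in> V" "v \<noteq> 0"
  obtains u c where "u \<in> V" "u \<noteq> 0" "T u = c *s u"
proof -
  have "(T ^^ k) v \<in> V" for k using assms(4,5) by (induction k) auto
  then obtain n c where c: "(\<Sum>k\<le>n. c k *s (T ^^ k) v) = 0" "\<exists>k\<le>n. c k \<noteq> (0::complex)"
    using fdim_dependent_seq[OF assms(1), of "\<lambda>k. (T ^^ k) v"] by blast
  define f where "f = (\<Sum>k\<le>n. monom (c k) k)"
  have cf: "coeff f k = (if k \<le> n then c k else 0)" for k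
    unfolding f_def by (simp add: coeff_sum sum.delta)
  then have "degree f \<le> n" by (intro degree_le) simp
  then have "polyD sc T f v = 0" using c(1) by (simp add: polyD_eq cf)
  moreover have "f \<noteq> 0" using c(2) cf by (metis coeff_0)
  ultimately show ?thesis using eigenvector_of_annihilator[OF assms(2,3) _ assms(5,6)] assms(4) that by blast
qed

text \<open>Applying T - \<open>d a\<close> to y - k a removes a and leaves (\<nu> -
  \<open>d a\<close>) y, which therefore lies in the span of the smaller set. The values of
  \<open>d\<close> may repeat and t may be dependent.\<close>

lemma eigenvector_in_span_eq_0:
  assumes "lin T" "finite t" "\<And>g. g \<in> t \<Longrightarrow> T g = d g *s g" "\<And>g. g \<in> t \<Longrightarrow> d g \<noteq> \<nu>"
    "y \<in> span t" "T y = \<nu> *s y"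
  shows "y = 0"
  using assms(2-)
proof (induction t arbitrary: y rule: finite_induct)
  case empty
  then show ?case by simp
next
  case (insert a t)
  obtain k where k: "y - k *s a \<in> span t"
    using insert.prems(3) by (auto simp: span_breakdown_eq)
  let ?z = "y - k *s a"
  have "T s \<in> span t" if "s \<in> t" for s
    using that insert.prems(1) by (simp add: span_scale span_base)
  then have "T ?z \<in> span t" using k by (rule span_stable[OF assms(1)])
  then have "T ?z - d a *s ?z \<in> span t" by (rule span_diff) (rule span_scale[OF k])
  moreover have "T ?z - d a *s ?z = (\<nu> - d a) *s y"
    using insert.prems(1)[of a] insert.prems(4) assms(1)
    by (simp add: lin_simps algebra_simps)
  ultimately have "(1 / (\<nu> - d a)) *s (\<nu> - d a) *s y \<in> span t"
    by (metis span_scale)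
  then have "y \<in> span t" using insert.prems(2)[of a] by simp
  then show ?case using insert.IH insert.prems by blast
qed

text \<open>Subtracting the part of y carried by the eigenvalue \<nu> leaves an eigenvector for
  \<nu> in the span of the other eigenvectors, hence zero.\<close>

lemma eigenvector_in_span:
  assumes T: "lin T" and G: "\<And>g. g \<in> G \<Longrightarrow> T g = d g *s g"
    and y: "y \<in> span G" "T y = \<nu> *s y"
  shows "y \<in> span {g \<in> G. d g = \<nu>}"
proof -
  have "G = {g \<in> G. d g = \<nu>} \<union> {g \<in> G. d g \<noteq> \<nu>}" by blast
  then obtain a b where ab: "a \<in> span {g \<in> G. d g = \<nu>}" "b \<in> span {g \<in> G. d g \<noteq> \<nu>}" "y = a + b"
    using y(1) span_Un[of "{g \<in> G. d g = \<nu>}" "{g \<in> G. d g \<noteq> \<nu>}"] by auto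
  obtain t r where t: "finite t" "t \<subseteq> {g \<in> G. d g \<noteq> \<nu>}" "b = (\<Sum>g\<in>t. r g *s g)"
    using ab(2) unfolding span_explicit by blast
  have "T a = \<nu> *s a"
    using ab(1)
    by (induction rule: span_induct_alt) (auto simp: T G lin_simps algebra_simps)
  then have "T b = \<nu> *s b" using y(2) ab(3) T by (simp add: lin_simps algebra_simps)
  moreover have "b \<in> span t" unfolding t(3) by (intro span_sum span_scale span_base)
  ultimately have "b = 0" using t G by (intro eigenvector_in_span_eq_0[OF T t(1)]) auto
  then show ?thesis using ab by simp
qed

lemma fdim_eigenvalue_progression:
  assumes "fdim V" "lin T" "\<And>k. x k \<in> V" "\<And>k. T (x k) = (\<mu> + of_nat k * b) *s x k" "b \<noteq> 0"
  shows "\<exists>k::nat. x k = 0"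
proof -
  obtain n c where c: "(\<Sum>k\<le>n. c k *s x k) = 0" "\<exists>k\<le>n. c k \<noteq> (0::complex)"
    by (rule fdim_dependent_seq[OF assms(1), of x, OF assms(3)]) auto
  then obtain k where k: "k \<le> n" "c k \<noteq> 0" by blast
  have *: "c k *s x k = - (\<Sum>l\<in>{..n} - {k}. c l *s x l)"
    using c(1) k(1) sum.remove[of "{..n}" k "\<lambda>l. c l *s x l"] by (simp add: eq_neg_iff_add_eq_0)
  \<comment> \<open>Zero is dropped because every number is an eigenvalue for it, so that
    \<open>d\<close> below would be arbitrary there.\<close>
  let ?G = "x ` ({..n} - {k}) - {0}"
  have "x k \<in> span ?G"
  proof -
    have "x l \<in> span ?G" if "l \<in> {..n} - {k}" for l
      using that by (cases "x l = 0") (auto intro: span_base span_zero)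
    then have "c k *s x k \<in> span ?G"
      unfolding * by (intro span_neg span_sum span_scale) auto
    then have "(1 / c k) *s c k *s x k \<in> span ?G" by (rule span_scale)
    then show ?thesis using k(2) by simp
  qed
  moreover define d where "d g = (SOME e. T g = e *s g)" for g
  have d: "T g = d g *s g \<and> d g \<noteq> \<mu> + of_nat k * b" if "g \<in> ?G" for g
  proof -
    from that obtain l where l: "g = x l" "l \<noteq> k" "x l \<noteq> 0" by auto
    have 1: "T g = d g *s g" unfolding d_def l(1) by (rule someI, rule assms(4))
    then have "d g = \<mu> + of_nat l * b" using l assms(4)[of l] scale_cancel_right by metis
    then show ?thesis using 1 l(2) assms(5) by simp
  qed
  ultimately have "x k = 0"
    using d assms(4) by (intro eigenvector_in_span_eq_0[OF assms(2), of ?G d "\<mu> + of_nat k * b"]) auto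
  then show ?thesis ..
qed

text \<open>The last nonzero \<open>x\<^sup>k v\<close> would be annihilated by \<open>y\<close> although \<open>y x\<^sup>k\<^sup>+\<^sup>1 v\<close> is
  a nonzero multiple of \<open>x\<^sup>k v\<close>.\<close>

lemma heisenberg_contradiction:
  assumes "lin x" "v \<noteq> 0" "y v = 0" "\<gamma> \<noteq> 0" "\<exists>k. (x ^^ k) v = 0" "lin y"
    and step: "\<And>k. y ((x ^^ Suc k) v) = x (y ((x ^^ k) v)) + \<gamma> *s (x ^^ k) v"
  shows False
proof -
  have y: "y ((x ^^ Suc k) v) = (of_nat (Suc k) * \<gamma>) *s (x ^^ k) v" for k
  proof (induction k)
    case 0
    then show ?case using step[of 0] assms(1,3) by (simp add: lin_zero)
  next
    case (Suc k)
    have "y ((x ^^ Suc (Suc k)) v) =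
        (of_nat (Suc k) * \<gamma>) *s (x ^^ Suc k) v + \<gamma> *s (x ^^ Suc k) v"
      unfolding step[of "Suc k"] Suc.IH lin_scale[OF assms(1)] by simp
    also have "\<dots> = (of_nat (Suc k) * \<gamma> + \<gamma>) *s (x ^^ Suc k) v"
      by (rule scale_left_distrib[symmetric])
    also have "of_nat (Suc k) * \<gamma> + \<gamma> = of_nat (Suc (Suc k)) * \<gamma>"
      by (simp add: algebra_simps)
    finally show ?case .
  qed
  define k where "k = (LEAST k. (x ^^ k) v = 0)"
  have k: "(x ^^ k) v = 0" unfolding k_def by (rule LeastI_ex) (rule assms(5))
  then obtain l where l: "k = Suc l" using assms(2) by (cases k) auto
  have "(x ^^ l) v \<noteq> 0" using l not_less_Least[of l "\<lambda>k. (x ^^ k) v = 0"] k_def by auto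
  then show False using y[of l] k l assms(4,6) by (simp add: lin_zero del: of_nat_Suc)
qed

end

section \<open>Modules over the mode algebra\<close>

text \<open>\<open>X i n\<close> stands for n! times the coefficient of \<lambda>^n in L_i. The
  truncated subtractions are harmless: for n = 0 in \<open>X_D\<close> and m = n = 0 in
  \<open>X_comm\<close> the scalar in front is zero. Finite generation is phrased through D-stable
  subspaces so that it serves as an induction principle.\<close>

locale block_module = complex_space sc
  for sc :: "complex \<Rightarrow> 'm::ab_group_add \<Rightarrow> 'm" (infixr "*s" 75) +
  fixes p :: complex and D :: "'m \<Rightarrow> 'm" and X :: "nat \<Rightarrow> nat \<Rightarrow> 'm \<Rightarrow> 'm"
  assumes p_nonzero: "p \<noteq> 0"
    and lin_D: "lin D" and lin_X: "lin (X i n)"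
    and X_D: "X i n (D v) = D (X i n v) + of_nat n *s X i (n - 1) v"
    and X_comm: "X i m (X j n v) = X j n (X i m v) +
      (of_nat m * (of_nat j + p) - of_nat n * (of_nat i + p)) *s X (i + j) (m + n - 1) v"
    and X_finite: "\<exists>N. \<forall>n\<ge>N. X i n v = 0"
    and fin_gen: "\<exists>S. finite S \<and>
      (\<forall>V. subspace V \<longrightarrow> S \<subseteq> V \<longrightarrow> (\<forall>v\<in>V. D v \<in> V) \<longrightarrow> V = UNIV)"
    and irred: "subspace V \<Longrightarrow> (\<And>v. v \<in> V \<Longrightarrow> D v \<in> V) \<Longrightarrow> (\<And>i n v. v \<in> V \<Longrightarrow> X i n v \<in> V)
      \<Longrightarrow> V = {0} \<or> V = UNIV"
    and nontrivial: "\<exists>i n v. X i n v \<noteq> 0"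
begin

lemmas D_simps = lin_simps[OF lin_D]
  and X_simps = lin_simps[OF lin_X]

lemma submodule_UNIV:
  assumes "subspace V" "\<And>v. v \<in> V \<Longrightarrow> D v \<in> V" "\<And>i n v. v \<in> V \<Longrightarrow> X i n v \<in> V"
    "v \<in> V" "v \<noteq> 0"
  shows "w \<in> V"
  using irred[OF assms(1-3)] assms(4,5) by auto

text \<open>The eigenspace of an operator commuting with the whole action is a submodule, so a
  single eigenvector determines T.\<close>

lemma schur:
  assumes "lin T" "\<And>v. T (D v) = D (T v)" "\<And>i n v. T (X i n v) = X i n (T v)"
    "v \<noteq> 0" "T v = c *s v"
  shows "T w = c *s w"
proof -
  have "w \<in> {w. T w = c *s w}"
    by (rule submodule_UNIV[of _ v])
      (auto simp: assms(2-5) lin_simps[OF assms(1)] D_simps X_simps algebra_simps intro!: subspaceI)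
  then show ?thesis by simp
qed

lemma X_faithful:
  assumes "\<And>i n. X i n v = 0"
  shows "v = 0"
proof (rule ccontr)
  assume v: "v \<noteq> 0"
  have "w \<in> {w. \<forall>i n. X i n w = 0}" for w
    by (rule submodule_UNIV[of _ v]) (auto simp: assms v X_simps D_simps X_D intro!: subspaceI)
  then show False using nontrivial by auto
qed

lemma top_index:
  assumes "X i n v \<noteq> 0"
  obtains d where "X i d v \<noteq> 0" "\<forall>k>d. X i k v = 0"
proof -
  obtain N where N: "\<forall>n\<ge>N. X i n v = 0" using X_finite by blast
  let ?d = "GREATEST k. X i k v \<noteq> 0"
  have b: "\<forall>k. X i k v \<noteq> 0 \<longrightarrow> k \<le> N" using N by (metis nat_le_linear)
  have "X i ?d v \<noteq> 0" using GreatestI_nat[of "\<lambda>k. X i k v \<noteq> 0", OF assms] b by blast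
  moreover have "X i k v = 0" if "k > ?d" for k
    using Greatest_le_nat[of "\<lambda>k. X i k v \<noteq> 0" k N] b that by force
  ultimately show ?thesis using that by blast
qed

text \<open>In terms of \<lambda>, L_i (\<partial>^n v) = (\<partial> + \<lambda>)^n L_i v has the
  same leading coefficient as L_i v; the factorials come from the normalisation of X.\<close>

lemma X_funpow_D_top:
  assumes "\<forall>k>d. X i k v = 0"
  shows "k > d + n \<Longrightarrow> X i k ((D ^^ n) v) = 0"
    and "X i (d + n) ((D ^^ n) v) = (fact (d + n) / fact d) *s X i d v"
proof -
  have *: "\<forall>k>d + n. X i k ((D ^^ n) v) = 0" for n
    by (induction n) (use assms in \<open>auto simp: X_D D_simps\<close>)
  then show "k > d + n \<Longrightarrow> X i k ((D ^^ n) v) = 0" by blast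
  show "X i (d + n) ((D ^^ n) v) = (fact (d + n) / fact d) *s X i d v"
    by (induction n) (use * in \<open>auto simp: X_D D_simps algebra_simps\<close>)
qed

text \<open>The leading coefficient of f(\<partial> + \<lambda>) L_i v is
  \<open>lead_coeff f\<close> times that of L_i v, so f(\<partial>) v = 0 forces every L_i v to
  vanish.\<close>

lemma torsion_free:
  assumes "f \<noteq> 0" "polyD sc D f v = 0"
  shows "v = 0"
proof (rule ccontr)
  assume "v \<noteq> 0"
  then obtain i n where "X i n v \<noteq> 0" using X_faithful by blast
  then obtain d where d: "X i d v \<noteq> 0" "\<forall>k>d. X i k v = 0" by (rule top_index)
  let ?n = "degree f"
  have "X i (d + ?n) (polyD sc D f v) = (\<Sum>k\<le>?n. coeff f k *s X i (d + ?n) ((D ^^ k) v))"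
    unfolding polyD_def by (simp add: lin_sum[OF lin_X] X_simps)
  also have "\<dots> = (\<Sum>k\<in>{?n}. coeff f k *s X i (d + ?n) ((D ^^ k) v))"
    using X_funpow_D_top(1)[OF d(2)] by (intro sum.mono_neutral_right) auto
  also have "\<dots> = (lead_coeff f * (fact (d + ?n) / fact d)) *s X i d v"
    using X_funpow_D_top(2)[OF d(2)] by simp
  finally show False using assms d(1) by (simp add: X_simps)
qed

text \<open>A top coefficient \<open>u\<close> of \<open>L\<^sub>j v\<close> is also one of \<open>L\<^sub>j (D v)\<close>, in the next index; the two
  descriptions give different eigenvalues of \<open>X 0 1\<close> on \<open>u\<close>.\<close>

lemma X0_faithful:
  assumes "\<And>n. X 0 n v = 0"
  shows "v = 0"
proof (rule X_faithful)
  fix j n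
  show "X j n v = 0"
  proof (rule ccontr)
    assume "X j n v \<noteq> 0"
    then obtain d where d: "X j d v \<noteq> 0" "\<forall>k>d. X j k v = 0" by (rule top_index)
    have "X 0 1 (X j (Suc d) (D v)) = (of_nat j + p - of_nat (Suc d) * p) *s X j (Suc d) (D v)"
      using X_comm[of 0 1 j "Suc d" "D v"] assms by (simp add: X_D D_simps X_simps)
    moreover have "X j (Suc d) (D v) = of_nat (Suc d) *s X j d v"
      using d(2) by (simp add: X_D D_simps)
    ultimately have "of_nat (Suc d) *s X 0 1 (X j d v) =
        of_nat (Suc d) *s (of_nat j + p - of_nat (Suc d) * p) *s X j d v"
      by (simp add: X_simps mult.commute)
    then have "X 0 1 (X j d v) = (of_nat j + p - of_nat (Suc d) * p) *s X j d v"
      by (subst (asm) scale_cancel_left) (auto simp del: of_nat_Suc)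
    moreover have "X 0 1 (X j d v) = (of_nat j + p - of_nat d * p) *s X j d v"
      using X_comm[of 0 1 j d v] assms by (simp add: X_simps)
    ultimately show False using d(1) p_nonzero by (auto simp: algebra_simps)
  qed
qed

text \<open>The coefficient of \<nu>^l / l! after substituting \<lambda> = \<nu> - \<partial> in the
  series L_i v, cut off at N; signs and factorials come from expanding (\<nu> - \<partial>)^n /
  n!.\<close>

definition jet :: "nat \<Rightarrow> nat \<Rightarrow> nat \<Rightarrow> 'm \<Rightarrow> 'm"
  where "jet i N l v = (\<Sum>m\<le>N. ((- 1) ^ m / fact m) *s (D ^^ m) (X i (l + m) v))"

lemma lin_jet: "lin (jet i N l)"
  unfolding jet_def
  by (rule linI) (simp_all add: X_simps lin_simps[OF lin_funpow[OF lin_D]] scale_right_distrib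
      sum.distrib scale_sum_right algebra_simps)

lemma jet_stable:
  assumes "\<forall>k\<ge>N. X i k v = 0" "N \<le> M"
  shows "jet i M l v = jet i N l v"
  unfolding jet_def using assms
  by (intro sum.mono_neutral_right) (auto simp: lin_zero[OF lin_funpow[OF lin_D]])

text \<open>The series \<open>L\<^sub>i v\<close> in \<open>\<lambda>\<close>, rewritten in terms of \<open>\<nu> = \<partial> + \<lambda>\<close> with the powers of
  \<open>\<partial>\<close> on the left. Passing from \<open>v\<close> to \<open>\<partial> v\<close> then multiplies by \<open>\<nu>\<close>, so that the
  coefficients of all \<open>v\<close> lie in one finite-dimensional space.\<close>

definition nu_coeff :: "nat \<Rightarrow> nat \<Rightarrow> 'm \<Rightarrow> 'm"
  where "nu_coeff i l v = jet i (SOME N. \<forall>k\<ge>N. X i k v = 0) l v"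

lemma nu_coeff_eq:
  assumes "\<forall>k\<ge>N. X i k v = 0"
  shows "nu_coeff i l v = jet i N l v"
proof -
  let ?M = "SOME N. \<forall>k\<ge>N. X i k v = 0"
  have M: "\<forall>k\<ge>?M. X i k v = 0" by (rule someI_ex[OF X_finite])
  show ?thesis
    unfolding nu_coeff_def
    using jet_stable[OF assms, of "max ?M N" l] jet_stable[OF M, of "max ?M N" l] by simp
qed

lemma lin_nu_coeff: "lin (nu_coeff i l)"
proof (rule linI)
  fix x y c
  obtain M N where "\<forall>k\<ge>M. X i k x = 0" "\<forall>k\<ge>N. X i k y = 0" using X_finite by metis
  then have *: "X i k x = 0 \<and> X i k y = 0 \<and> X i k (x + y) = 0 \<and> X i k (c *s x) = 0"
    if "k \<ge> max M N" for k
    using that by (simp add: X_simps)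
  show "nu_coeff i l (x + y) = nu_coeff i l x + nu_coeff i l y"
    using * by (simp add: nu_coeff_eq[of "max M N"] lin_add[OF lin_jet])
  show "nu_coeff i l (c *s x) = c *s nu_coeff i l x"
    using * by (simp add: nu_coeff_eq[of "max M N"] lin_scale[OF lin_jet])
qed

lemma nu_coeff_D: "nu_coeff i l (D v) = of_nat l *s nu_coeff i (l - 1) v"
proof -
  obtain N0 where N0: "\<forall>k\<ge>N0. X i k v = 0" using X_finite by blast
  \<comment> \<open>One more than the cutoff of v, because \<open>X i k (D v)\<close> involves
    \<open>X i (k - 1) v\<close>.\<close>
  define N where "N = Suc N0"
  have N: "X i k v = 0" if "k \<ge> N" for k using N0 that by (simp add: N_def)
  have N': "X i k (D v) = 0" if "k \<ge> N" for k using N0 that by (auto simp: X_D D_simps N_def)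
  define c :: "nat \<Rightarrow> complex" where "c m = (- 1) ^ m / fact m" for m
  have c: "c (Suc m) * of_nat (Suc m) = - c m" for m
    by (simp add: c_def field_simps del: of_nat_Suc)
  let ?Y = "\<lambda>m. (D ^^ Suc m) (X i (l + m) v)"
  have lp: "lin (D ^^ m)" for m by (rule lin_funpow[OF lin_D])
  have "jet i N l (D v) = (\<Sum>m\<le>N. c m *s (?Y m + of_nat (l + m) *s (D ^^ m) (X i (l + m - 1) v)))"
    unfolding jet_def c_def[symmetric] X_D
    by (simp add: lin_simps[OF lp] funpow_swap1)
  also have "\<dots> = (\<Sum>m\<le>N. c m *s ?Y m) + (\<Sum>m\<le>N. (c m * of_nat m) *s (D ^^ m) (X i (l + m - 1) v))
      + (\<Sum>m\<le>N. (c m * of_nat l) *s (D ^^ m) (X i (l + m - 1) v))"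
    by (simp add: sum.distrib[symmetric] scale_right_distrib scale_left_distrib algebra_simps)
  \<comment> \<open>By \<open>c\<close>, reindexing makes this sum the negative of the first one;
    only the sum with the factor l survives.\<close>
  also have "(\<Sum>m\<le>N. (c m * of_nat m) *s (D ^^ m) (X i (l + m - 1) v)) =
      (\<Sum>m\<le>N0. (- c m) *s ?Y m)"
    unfolding N_def by (subst sum.atMost_Suc_shift) (simp add: c del: of_nat_Suc funpow.simps)
  also have "(\<Sum>m\<le>N. c m *s ?Y m) = (\<Sum>m\<le>N0. c m *s ?Y m)"
    using N by (simp add: N_def lin_zero[OF lp] D_simps)
  also have "(\<Sum>m\<le>N. (c m * of_nat l) *s (D ^^ m) (X i (l + m - 1) v)) =
      of_nat l *s jet i N (l - 1) v"
    by (cases l) (simp_all add: jet_def c_def[symmetric] scale_sum_right algebra_simps)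
  finally show ?thesis
    using N N' by (simp add: nu_coeff_eq[of N] sum_negf)
qed

text \<open>The change of variable is triangular: once \<open>X i r v\<close> = 0 for all r > k, the
  sum \<open>jet i N k v\<close> reduces to \<open>X i k v\<close>. Hence the descending
  induction.\<close>

lemma nu_coeff_faithful:
  assumes "\<And>l. nu_coeff i l v = 0"
  shows "X i n v = 0"
proof -
  obtain N where N: "\<forall>k\<ge>N. X i k v = 0" using X_finite by blast
  have "\<forall>k\<ge>N - m. X i k v = 0" for m
  proof (induction m)
    case 0
    then show ?case using N by simp
  next
    case (Suc m)
    show ?case
    proof (intro allI impI)
      fix k assume k: "N - Suc m \<le> k"
      show "X i k v = 0"
      proof (cases "k \<ge> N - m")
        case True
        then show ?thesis using Suc by blast
      next
        case False
        then have "X i (k + r) v = 0" if "r > 0" for r using k Suc that by auto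
        then have "jet i N k v = (\<Sum>r\<in>{0}. ((- 1) ^ r / fact r) *s (D ^^ r) (X i (k + r) v))"
          unfolding jet_def
          by (intro sum.mono_neutral_right) (auto simp: lin_zero[OF lin_funpow[OF lin_D]])
        then show ?thesis using nu_coeff_eq[of N i v k] N assms by simp
      qed
    qed
  qed
  from this[of N] show ?thesis by simp
qed

text \<open>By \<open>nu_coeff_D\<close> the vectors whose coefficients lie in a fixed span form a
  D-stable subspace, so it is enough to collect the finitely many nonzero coefficients of the
  generators.\<close>

lemma nu_coeff_fdim: "\<exists>U. finite U \<and> (\<forall>l v. nu_coeff i l v \<in> span U)"
proof -
  obtain S where S: "finite S"
    "\<And>V. subspace V \<Longrightarrow> S \<subseteq> V \<Longrightarrow> (\<forall>v\<in>V. D v \<in> V) \<Longrightarrow> V = UNIV"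
    using fin_gen by auto
  obtain N where N: "\<And>s k. k \<ge> N s \<Longrightarrow> X i k s = 0" using X_finite by metis
  define U where "U = (\<lambda>(s, l). nu_coeff i l s) ` (Sigma S (\<lambda>s. {..N s}))"
  have U: "nu_coeff i l s \<in> span U" if "s \<in> S" for s l
  proof (cases "l \<le> N s")
    case True
    then show ?thesis using that unfolding U_def by (intro span_base) force
  next
    case False
    then have "nu_coeff i l s = 0"
      using nu_coeff_eq[of "N s" i s l] N
      by (simp add: jet_def lin_zero[OF lin_funpow[OF lin_D]])
    then show ?thesis by (simp add: span_zero)
  qed
  have "{v. \<forall>l. nu_coeff i l v \<in> span U} = UNIV"
    using U by (intro S(2))
      (auto intro!: subspaceI span_add span_scale span_zero simp: nu_coeff_D lin_simps[OF lin_nu_coeff])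
  moreover have "finite U" unfolding U_def using S(1) by auto
  ultimately show ?thesis by blast
qed

text \<open>On the cutoff space the \<nu>-coefficients with l >= n vanish too, so those with l < n
  are jointly injective, with values in a finite span. Passing from \<open>?W l\<close> to
  \<open>?W (Suc l)\<close> kills one of them.\<close>

lemma X_cutoff_fdim:
  assumes faithful: "\<And>v. (\<And>k. X i k v = 0) \<Longrightarrow> v = 0"
  shows "fdim {v. \<forall>k\<ge>n. X i k v = 0}"
proof -
  let ?V = "{v. \<forall>k\<ge>n. X i k v = 0}"
  let ?W = "\<lambda>l. {v \<in> ?V. \<forall>k<l. nu_coeff i k v = 0}"
  obtain U where U: "finite U" "\<forall>l v. nu_coeff i l v \<in> span U" using nu_coeff_fdim by blast
  have sub: "subspace (?W l)" for l
    by (rule subspaceI) (auto simp: X_simps lin_simps[OF lin_nu_coeff])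
  have "fdim (?W (n - m))" if "m \<le> n" for m
    using that
  proof (induction m)
    case 0
    have "v = 0" if "v \<in> ?W n" for v
    proof (rule faithful, rule nu_coeff_faithful)
      fix l
      show "nu_coeff i l v = 0"
      proof (cases "l < n")
        case False
        then have "\<And>r. X i (l + r) v = 0" using that by auto
        then show ?thesis using that nu_coeff_eq[of n i v l]
          by (simp add: jet_def lin_zero[OF lin_funpow[OF lin_D]])
      qed (use that in auto)
    qed
    then have "?W n \<subseteq> {0}" by blast
    then show ?case using fdim_subset[OF fdim_zero] by simp
  next
    case (Suc m)
    let ?l = "n - Suc m"
    have l: "n - m = Suc ?l" using Suc.prems by simp
    have "{v \<in> ?W ?l. nu_coeff i ?l v = 0} = ?W (n - m)" unfolding l by (auto simp: less_Suc_eq)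
    then have k: "fdim {v \<in> ?W ?l. nu_coeff i ?l v = 0}" using Suc by simp
    have "fdim (nu_coeff i ?l ` ?W ?l)" unfolding fdim_def using U by blast
    then show ?case using fdim_kernel_image[OF lin_nu_coeff sub _ k] by blast
  qed
  from this[of n] show ?thesis by simp
qed

lemma X0_cutoff_fdim: "fdim {v. \<forall>k\<ge>n. X 0 k v = 0}"
  by (rule X_cutoff_fdim) (rule X0_faithful)

section \<open>The grading by the Euler operator\<close>

text \<open>Schur's lemma needs one eigenvector of T; a cutoff space supplies it, being stable
  because T commutes with every \<open>X 0 k\<close>.\<close>

lemma ex_alpha: "\<exists>a. \<forall>v. X 0 0 v = p *s (D v + a *s v)"
proof -
  obtain i n v where "X i n v \<noteq> 0" using nontrivial by blast
  then have v: "v \<noteq> 0" by (auto simp: X_simps)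
  obtain N where N: "\<forall>k\<ge>N. X 0 k v = 0" using X_finite by blast
  let ?V = "{v. \<forall>k\<ge>N. X 0 k v = 0}"
  define T where "T w = D w - (1 / p) *s X 0 0 w" for w
  have T: "lin T"
    unfolding T_def by (rule linI) (simp_all add: D_simps X_simps algebra_simps)
  have TD: "T (D w) = D (T w)" for w by (simp add: T_def D_simps X_simps X_D)
  have TX: "T (X j n w) = X j n (T w)" for j n w
  proof -
    have "X j n (X 0 0 w) = X 0 0 (X j n w) + (of_nat n * p) *s X j (n - 1) w"
      using X_comm[of 0 0 j n w] by (simp add: algebra_simps)
    then have "(1 / p) *s X j n (X 0 0 w) = (1 / p) *s X 0 0 (X j n w) + of_nat n *s X j (n - 1) w"
      using p_nonzero by (simp add: scale_right_distrib)
    then show ?thesis by (simp add: T_def X_simps X_D algebra_simps)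
  qed
  have sub: "subspace ?V" by (rule subspaceI) (auto simp: X_simps)
  have stable: "T ` ?V \<subseteq> ?V" by (auto simp: TX[symmetric] lin_zero[OF T])
  have "v \<in> ?V" using N by simp
  then obtain u c where "u \<in> ?V" and u: "u \<noteq> 0" "T u = c *s u"
    by (rule fdim_eigenvector[OF X0_cutoff_fdim T sub stable _ v])
  have "T w = c *s w" for w by (rule schur[OF T TD TX u])
  then have "D w - c *s w = (1 / p) *s X 0 0 w" for w
    unfolding T_def by (metis diff_diff_eq2 add_diff_cancel_left' diff_add_cancel)
  then have "X 0 0 w = p *s (D w + (- c) *s w)" for w
    using p_nonzero by simp
  then show ?thesis by blast
qed

definition alpha :: complex
  where "alpha = (SOME a. \<forall>v. X 0 0 v = p *s (D v + a *s v))"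

text \<open>The shift by \<open>alpha\<close> turns \<open>X 0 0\<close> into p \<open>dd\<close>,
  so that \<open>dd\<close> raises Euler weights by exactly 1 without a correction term.\<close>

definition dd :: "'m \<Rightarrow> 'm"
  where "dd v = D v + alpha *s v"

definition euler :: "'m \<Rightarrow> 'm"
  where "euler v = (1 / p) *s X 0 1 v"

lemma X_0_0: "X 0 0 v = p *s dd v"
  using someI_ex[OF ex_alpha] unfolding alpha_def dd_def by blast

lemma X_0_1: "X 0 1 v = p *s euler v"
  using p_nonzero by (simp add: euler_def)

lemma lin_dd: "lin dd"
  unfolding dd_def by (rule linI) (simp_all add: D_simps algebra_simps)

lemma lin_euler: "lin euler"
  unfolding euler_def by (rule linI) (simp_all add: X_simps algebra_simps)

lemmas dd_simps = lin_simps[OF lin_dd]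
  and euler_simps = lin_simps[OF lin_euler]

lemma X_dd: "X i n (dd v) = dd (X i n v) + of_nat n *s X i (n - 1) v"
  by (simp add: dd_def X_D X_simps algebra_simps)

lemma euler_dd: "euler (dd v) = dd (euler v) + dd v"
  using X_dd[of 0 1 v] p_nonzero by (simp add: X_0_0 euler_def dd_simps algebra_simps)

lemma euler_X: "euler (X j n v) = X j n (euler v) + (of_nat j / p + 1 - of_nat n) *s X j n v"
proof -
  have "euler (X j n v) = (1 / p) *s (X j n (X 0 1 v) + (of_nat j + p - of_nat n * p) *s X j n v)"
    using X_comm[of 0 1 j n v] by (simp add: euler_def)
  also have "\<dots> = X j n (euler v) + ((1 / p) * (of_nat j + p - of_nat n * p)) *s X j n v"
    by (simp add: euler_def X_simps scale_right_distrib)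
  also have "(1 / p) * (of_nat j + p - of_nat n * p) = of_nat j / p + 1 - of_nat n"
    using p_nonzero by (simp add: field_simps)
  finally show ?thesis .
qed

lemma euler_dd_eigen: "euler v = \<mu> *s v \<Longrightarrow> euler (dd v) = (\<mu> + 1) *s dd v"
  by (simp add: euler_dd dd_simps algebra_simps)

lemma euler_funpow_dd_eigen:
  "euler v = \<mu> *s v \<Longrightarrow> euler ((dd ^^ n) v) = (of_nat n + \<mu>) *s (dd ^^ n) v"
proof (induction n)
  case (Suc n)
  then show ?case using euler_dd_eigen[OF Suc.IH[OF Suc.prems]] by (simp add: algebra_simps)
qed simp

lemma euler_X_eigen:
  "euler v = \<mu> *s v \<Longrightarrow> euler (X j n v) = (\<mu> + (of_nat j / p + 1 - of_nat n)) *s X j n v"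
  by (simp add: euler_X X_simps algebra_simps)

lemma dd_eq_0: "dd v = 0 \<Longrightarrow> v = 0"
  using torsion_free[of "[:alpha, 1:]" v]
  by (simp add: polyD_pCons[OF lin_D] dd_def D_simps algebra_simps)

lemma funpow_dd_eq_0: "(dd ^^ n) v = 0 \<Longrightarrow> v = 0"
  by (induction n) (auto dest: dd_eq_0)

text \<open>\<open>dd\<close> and all modes send eigenvectors to eigenvectors, so their span is a
  submodule; a cutoff space, stable under \<open>euler\<close>, contains a nonzero one.\<close>

lemma span_eigenvectors: "span {v. \<exists>\<mu>. euler v = \<mu> *s v} = UNIV"
proof -
  let ?S = "{v. \<exists>\<mu>. euler v = \<mu> *s v}"
  obtain i n v where "X i n v \<noteq> 0" using nontrivial by blast
  then have v: "v \<noteq> 0" by (auto simp: X_simps)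
  obtain N where N: "\<forall>k\<ge>N. X 0 k v = 0" using X_finite by blast
  let ?V = "{v. \<forall>k\<ge>N. X 0 k v = 0}"
  have sub: "subspace ?V" by (rule subspaceI) (auto simp: X_simps)
  have "X 0 k (euler w) = 0" if "w \<in> ?V" "k \<ge> N" for w k
    using euler_X[of 0 k w] that by (simp add: euler_simps)
  then have stable: "euler ` ?V \<subseteq> ?V" by blast
  have "v \<in> ?V" using N by simp
  then obtain u c where "u \<in> ?V" and u: "u \<noteq> 0" "euler u = c *s u"
    by (rule fdim_eigenvector[OF X0_cutoff_fdim lin_euler sub stable _ v])
  have "w \<in> span ?S" for w
  proof (rule submodule_UNIV[of _ u])
    show "u \<in> span ?S" using u by (auto intro: span_base)
    show "D v \<in> span ?S" if "v \<in> span ?S" for v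
    proof -
      have "dd v \<in> span ?S"
        by (rule span_stable[OF lin_dd _ that]) (auto intro!: span_base dest: euler_dd_eigen)
      then have "dd v - alpha *s v \<in> span ?S" using that by (rule span_diff[OF _ span_scale])
      then show ?thesis by (simp add: dd_def)
    qed
    show "X i n v \<in> span ?S" if "v \<in> span ?S" for i n v
      by (rule span_stable[OF lin_X _ that]) (auto intro!: span_base dest: euler_X_eigen)
  qed (use u in auto)
  then show ?thesis by blast
qed

section \<open>Homogeneous generators over C[\<partial>], and weights bounded below\<close>

definition orbit :: "'m set \<Rightarrow> 'm set"
  where "orbit Q = {(dd ^^ n) s | n s. s \<in> Q}"

lemma orbit_base: "s \<in> Q \<Longrightarrow> (dd ^^ n) s \<in> span (orbit Q)"
  unfolding orbit_def by (rule span_base) blast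

lemma dd_orbit: "v \<in> span (orbit Q) \<Longrightarrow> dd v \<in> span (orbit Q)"
proof (rule span_stable[OF lin_dd])
  fix s assume "s \<in> orbit Q"
  then obtain n t where "s = (dd ^^ n) t" "t \<in> Q" unfolding orbit_def by blast
  then show "dd s \<in> span (orbit Q)" using orbit_base[of t Q "Suc n"] by simp
qed

lemma ex_gens:
  "\<exists>G. finite G \<and> 0 \<notin> G \<and> (\<forall>s\<in>G. \<exists>\<mu>. euler s = \<mu> *s s) \<and> span (orbit G) = UNIV"
proof -
  let ?S = "{v. \<exists>\<mu>. euler v = \<mu> *s v}"
  obtain S where S: "finite S"
    "\<And>V. subspace V \<Longrightarrow> S \<subseteq> V \<Longrightarrow> (\<forall>v\<in>V. D v \<in> V) \<Longrightarrow> V = UNIV"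
    using fin_gen by auto
  have "\<exists>t. finite t \<and> t \<subseteq> ?S \<and> s \<in> span t" for s
  proof -
    have "s \<in> span ?S" using span_eigenvectors by simp
    then obtain t r where "finite t" "t \<subseteq> ?S" "s = (\<Sum>a\<in>t. r a *s a)"
      unfolding span_explicit by blast
    then show ?thesis by (intro exI[of _ t]) (auto intro: span_sum span_scale span_base)
  qed
  then obtain t where t: "\<And>s. finite (t s)" "\<And>s. t s \<subseteq> ?S" "\<And>s. s \<in> span (t s)" by metis
  define G where "G = (\<Union>s\<in>S. t s) - {0}"
  have "span (orbit G) = UNIV"
  proof (rule S(2))
    show "S \<subseteq> span (orbit G)"
    proof
      fix s assume s: "s \<in> S"
      have "t s - {0} \<subseteq> span (orbit G)" using s orbit_base[of _ G 0] unfolding G_def by auto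
      then have "span (t s - {0}) \<subseteq> span (orbit G)" by (rule span_minimal) simp
      then show "s \<in> span (orbit G)" using t(3)[of s] by auto
    qed
    show "\<forall>v\<in>span (orbit G). D v \<in> span (orbit G)"
    proof
      fix v assume v: "v \<in> span (orbit G)"
      have "dd v - alpha *s v \<in> span (orbit G)"
        using dd_orbit[OF v] v by (rule span_diff[OF _ span_scale])
      then show "D v \<in> span (orbit G)" by (simp add: dd_def)
    qed
  qed simp
  then show ?thesis using S(1) t by (intro exI[of _ G]) (auto simp: G_def)
qed

definition gens :: "'m set"
  where "gens = (SOME G. finite G \<and> 0 \<notin> G \<and> (\<forall>s\<in>G. \<exists>\<mu>. euler s = \<mu> *s s) \<and>
    span (orbit G) = UNIV)"

definition wt :: "'m \<Rightarrow> complex"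
  where "wt s = (SOME \<mu>. euler s = \<mu> *s s)"

lemma gens: "finite gens" "0 \<notin> gens" "span (orbit gens) = UNIV"
  and euler_gens: "s \<in> gens \<Longrightarrow> euler s = wt s *s s"
proof -
  have *: "finite gens \<and> 0 \<notin> gens \<and> (\<forall>s\<in>gens. \<exists>\<mu>. euler s = \<mu> *s s) \<and> span (orbit gens) = UNIV"
    unfolding gens_def by (rule someI_ex[OF ex_gens])
  then show "finite gens" "0 \<notin> gens" "span (orbit gens) = UNIV" by auto
  show "euler s = wt s *s s" if "s \<in> gens"
    using * that unfolding wt_def by (metis (mono_tags, lifting) someI_ex)
qed

lemma wt_eq: "euler v = \<mu> *s v \<Longrightarrow> v \<noteq> 0 \<Longrightarrow> wt v = \<mu>"
  unfolding wt_def by (metis (mono_tags, lifting) scale_cancel_right someI_ex)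

lemma gens_nonempty: "gens \<noteq> {}"
proof
  assume "gens = {}"
  then have "UNIV = {0::'m}" using gens(3) by (simp add: orbit_def)
  then show False using nontrivial by (metis UNIV_I singletonD)
qed

text \<open>Torsion-freeness keeps each \<open>(dd ^^ n) s\<close> nonzero, so its weight is well
  defined and only those of weight \<nu> contribute to u.\<close>

lemma homogeneous_in_orbit:
  assumes "Q \<subseteq> gens" "u \<in> span (orbit Q)" "euler u = \<nu> *s u"
  shows "u \<in> span {(dd ^^ n) s | n s. s \<in> Q \<and> of_nat n + wt s = \<nu>}"
proof -
  have *: "euler ((dd ^^ n) s) = (of_nat n + wt s) *s (dd ^^ n) s"
    "wt ((dd ^^ n) s) = of_nat n + wt s" if "s \<in> Q" for n s
  proof -
    show 1: "euler ((dd ^^ n) s) = (of_nat n + wt s) *s (dd ^^ n) s"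
      using that assms(1) by (intro euler_funpow_dd_eigen euler_gens) auto
    have "(dd ^^ n) s \<noteq> 0" using that assms(1) gens(2) funpow_dd_eq_0 by blast
    then show "wt ((dd ^^ n) s) = of_nat n + wt s" using 1 by (intro wt_eq)
  qed
  have "u \<in> span {g \<in> orbit Q. wt g = \<nu>}"
    using assms(2,3) * by (intro eigenvector_in_span[OF lin_euler]) (auto simp: orbit_def)
  moreover have "{g \<in> orbit Q. wt g = \<nu>} \<subseteq> {(dd ^^ n) s | n s. s \<in> Q \<and> of_nat n + wt s = \<nu>}"
  proof
    fix g assume g: "g \<in> {g \<in> orbit Q. wt g = \<nu>}"
    then obtain n s where ns: "g = (dd ^^ n) s" "s \<in> Q" by (auto simp: orbit_def)
    then have "of_nat n + wt s = \<nu>" using g *(2)[of s n] by simp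
    with ns show "g \<in> {(dd ^^ n) s | n s. s \<in> Q \<and> of_nat n + wt s = \<nu>}"
      by blast
  qed
  ultimately show ?thesis using span_mono by blast
qed

text \<open>\<open>dd\<close> raises weights, so no vector of the orbit of \<open>gens\<close> has a
  weight with real part below that of all generators.\<close>

lemma homogeneous_eq_0:
  assumes "euler u = \<nu> *s u" "\<And>s. s \<in> gens \<Longrightarrow> Re \<nu> < Re (wt s)"
  shows "u = 0"
proof -
  have "u \<in> span {(dd ^^ n) s | n s. s \<in> gens \<and> of_nat n + wt s = \<nu>}"
    using assms(1) gens(3) by (intro homogeneous_in_orbit) auto
  moreover have "{(dd ^^ n) s | n s. s \<in> gens \<and> of_nat n + wt s = \<nu>} = {}"
    using assms(2) by fastforce
  ultimately show ?thesis by (metis (no_types, lifting) span_empty singletonD)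
qed

definition low :: 'm
  where "low = (SOME s. s \<in> gens \<and> (\<forall>t\<in>gens. Re (wt s) \<le> Re (wt t)))"

lemma low: "low \<in> gens" "t \<in> gens \<Longrightarrow> Re (wt low) \<le> Re (wt t)"
proof -
  have "\<exists>s. s \<in> gens \<and> (\<forall>t\<in>gens. Re (wt s) \<le> Re (wt t))"
    using arg_min_if_finite(1)[OF gens(1) gens_nonempty, of "\<lambda>s. Re (wt s)"]
      arg_min_least[OF gens(1) gens_nonempty, of _ "\<lambda>s. Re (wt s)"] by blast
  then have "low \<in> gens \<and> (\<forall>t\<in>gens. Re (wt low) \<le> Re (wt t))"
    unfolding low_def by (rule someI_ex)
  then show "low \<in> gens" "t \<in> gens \<Longrightarrow> Re (wt low) \<le> Re (wt t)" by auto
qed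

lemma low_nonzero: "low \<noteq> 0"
  using low gens(2) by metis

lemma euler_low: "euler low = wt low *s low"
  by (rule euler_gens[OF low(1)])

lemma X_low_eq_0:
  assumes "Re (of_nat j / p + 1 - of_nat n) < 0"
  shows "X j n low = 0"
proof (rule homogeneous_eq_0[OF euler_X_eigen[OF euler_low]])
  fix s assume "s \<in> gens"
  then show "Re (wt low + (of_nat j / p + 1 - of_nat n)) < Re (wt s)"
    using low(2)[of s] assms unfolding plus_complex.sel by linarith
qed

lemma X_0_low_eq_0: "n \<ge> 2 \<Longrightarrow> X 0 n low = 0"
  by (rule X_low_eq_0) simp

lemma X_0_nilpotent:
  assumes "euler v = \<mu> *s v"
  shows "\<exists>k. (X 0 2 ^^ k) v = 0"
proof -
  have e: "euler ((X 0 2 ^^ k) v) = (\<mu> - of_nat k) *s (X 0 2 ^^ k) v" for k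
  proof (induction k)
    case (Suc k)
    show ?case using euler_X_eigen[OF Suc.IH, of 0 2] by (simp add: algebra_simps)
  qed (use assms in simp)
  obtain k where k: "real k > Re \<mu> - Re (wt low)" using reals_Archimedean2 by blast
  have "(X 0 2 ^^ k) v = 0"
    using k low(2) by (intro homogeneous_eq_0[OF e]) fastforce
  then show ?thesis ..
qed

section \<open>Vanishing of high modes\<close>

lemma X_0_3_dd: "X 0 3 (dd v) = dd (X 0 3 v) + 3 *s X 0 2 v"
  using X_dd[of 0 3 v] by simp

lemma X_0_2_dd: "X 0 2 (dd v) = dd (X 0 2 v) + (2 * p) *s euler v"
  using X_dd[of 0 2 v] X_0_1[of v] by simp

text \<open>Moving \<open>X 0 2\<close> past one \<open>dd\<close> costs 2 p times the current
  weight; the constant is the sum of 2 p (\<delta> + k) over k < n. Working modulo P lets x be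
  singular only in a quotient.\<close>

lemma X_0_2_funpow_dd:
  assumes P: "subspace P" "\<And>v. v \<in> P \<Longrightarrow> dd v \<in> P"
    and x: "euler x = \<delta> *s x" "X 0 2 x \<in> P"
  shows "X 0 2 ((dd ^^ n) x) - (p * of_nat n * (2 * \<delta> + of_nat n - 1)) *s (dd ^^ (n - 1)) x \<in> P"
proof (induction n)
  case 0
  then show ?case using x by simp
next
  case (Suc n)
  let ?c = "p * of_nat n * (2 * \<delta> + of_nat n - 1)"
  have "dd (X 0 2 ((dd ^^ n) x) - ?c *s (dd ^^ (n - 1)) x) \<in> P" by (rule P(2)[OF Suc])
  \<comment> \<open>For n = 0 the exponent is truncated, but then \<open>?c\<close> is zero.\<close>
  moreover have "?c *s dd ((dd ^^ (n - 1)) x) = ?c *s (dd ^^ n) x"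
    by (cases n) auto
  ultimately have "dd (X 0 2 ((dd ^^ n) x)) - ?c *s (dd ^^ n) x \<in> P"
    by (simp only: dd_simps)
  moreover have "X 0 2 ((dd ^^ Suc n) x) =
      dd (X 0 2 ((dd ^^ n) x)) + (2 * p * (of_nat n + \<delta>)) *s (dd ^^ n) x"
    using euler_funpow_dd_eigen[OF x(1), of n] by (simp add: X_0_2_dd)
  moreover have "p * of_nat (Suc n) * (2 * \<delta> + of_nat (Suc n) - 1) = ?c + 2 * p * (of_nat n + \<delta>)"
    by (simp add: algebra_simps)
  ultimately show ?case by (simp only: scale_left_distrib diff_Suc_1 add_diff_cancel_right)
qed

text \<open>The constant c of exponent n grows by 3 b at each step, where b is the constant of
  \<open>X_0_2_funpow_dd\<close> for the same n.\<close>

lemma X_0_3_funpow_dd: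
  assumes P: "subspace P" "\<And>v. v \<in> P \<Longrightarrow> dd v \<in> P"
    and x: "euler x = \<delta> *s x" "X 0 2 x \<in> P" "X 0 3 x \<in> P"
  shows "X 0 3 ((dd ^^ n) x) -
    (p * of_nat n * (of_nat n - 1) * (of_nat n - 2 + 3 * \<delta>)) *s (dd ^^ (n - 2)) x \<in> P"
proof (induction n)
  case 0
  then show ?case using x by simp
next
  case (Suc n)
  define c where "c = p * of_nat n * (of_nat n - 1) * (of_nat n - 2 + 3 * \<delta>)"
  define b where "b = p * of_nat n * (2 * \<delta> + of_nat n - 1)"
  let ?w = "(dd ^^ (n - 1)) x"
  have "dd (X 0 3 ((dd ^^ n) x) - c *s (dd ^^ (n - 2)) x) \<in> P" unfolding c_def by (rule P(2)[OF Suc])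
  moreover have "c *s dd ((dd ^^ (n - 2)) x) = c *s (dd ^^ (n - 1)) x"
  proof (cases "n < 2")
    case True
    then show ?thesis by (cases n) (auto simp: c_def)
  next
    case False
    then obtain k where "n = Suc (Suc k)" by (metis less_2_cases_iff not0_implies_Suc One_nat_def)
    then show ?thesis by simp
  qed
  ultimately have 1: "dd (X 0 3 ((dd ^^ n) x)) - c *s (dd ^^ (n - 1)) x \<in> P"
    by (simp only: dd_simps)
  have "3 *s (X 0 2 ((dd ^^ n) x) - b *s (dd ^^ (n - 1)) x) \<in> P"
    unfolding b_def by (intro subspace_scale[OF P(1)] X_0_2_funpow_dd P x)
  then have "dd (X 0 3 ((dd ^^ n) x)) - c *s (dd ^^ (n - 1)) x +
      3 *s (X 0 2 ((dd ^^ n) x) - b *s (dd ^^ (n - 1)) x) \<in> P"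
    by (rule subspace_add[OF P(1) 1])
  moreover have "dd (X 0 3 ((dd ^^ n) x)) - c *s ?w + 3 *s (X 0 2 ((dd ^^ n) x) - b *s ?w)
      = X 0 3 ((dd ^^ Suc n) x) - (c + 3 * b) *s ?w"
    by (simp add: X_0_3_dd algebra_simps)
  moreover have "c + 3 * b = p * of_nat (Suc n) * (of_nat (Suc n) - 1) * (of_nat (Suc n) - 2 + 3 * \<delta>)"
    unfolding b_def c_def by (simp add: algebra_simps)
  moreover have "Suc n - 2 = n - 1" by simp
  ultimately show ?case by (simp only:)
qed

text \<open>Both sides are multiples of the second coefficient \<open>X j 2 low\<close>.\<close>

lemma X_j_0_low_relation:
  "3 *s X 0 2 (X 0 2 (X j 0 low)) = (2 * (2 * of_nat j + p)) *s X 0 3 (X j 0 low)"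
proof -
  have "X 0 2 (X j 0 low) = (2 * (of_nat j + p)) *s X j 1 low"
    using X_comm[of 0 2 j 0 low] by (simp add: X_0_low_eq_0 X_simps)
  moreover have "X 0 2 (X j 1 low) = (2 * of_nat j + p) *s X j 2 low"
    using X_comm[of 0 2 j 1 low] by (simp add: X_0_low_eq_0 X_simps numeral_2_eq_2 algebra_simps)
  moreover have "X 0 3 (X j 0 low) = (3 * (of_nat j + p)) *s X j 2 low"
    using X_comm[of 0 3 j 0 low] by (simp add: X_0_low_eq_0 X_simps numeral_2_eq_2)
  ultimately show ?thesis by (simp add: X_simps algebra_simps)
qed

text \<open>The generator \<open>x\<close> spans a density module of weight \<open>\<delta>\<close> modulo \<open>P\<close>, and \<open>X j 0 low\<close> is
  there a multiple of \<open>\<partial>\<^sup>N x\<close>. The relation above becomes a quadratic equation for \<open>N\<close>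
  with leading coefficient \<open>3 - 4\<close>, and \<open>N\<close> determines \<open>j\<close>.\<close>

lemma flag_step:
  assumes P: "subspace P" "\<And>v. v \<in> P \<Longrightarrow> dd v \<in> P" "\<And>v. v \<in> P \<Longrightarrow> X 0 2 v \<in> P"
      "\<And>v. v \<in> P \<Longrightarrow> X 0 3 v \<in> P"
    and x: "euler x = \<delta> *s x" "X 0 2 x \<in> P" "X 0 3 x \<in> P"
  shows "finite {j. \<exists>N c. X j 0 low \<notin> P \<and> X j 0 low - c *s (dd ^^ N) x \<in> P \<and>
    of_nat N + \<delta> = wt low + (of_nat j / p + 1)}"
proof -
  let ?\<mu> = "wt low"
  \<comment> \<open>This is 3 a a' - 2 (2 j + p) b divided by p^2 n (n - 1), with j = p (n +
    \<delta> - \<mu> - 1) from the weight condition and a, a', b as below.\<close>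
  define q where "q = [:2 * \<delta> - 1, 1:] * [:2 * \<delta> - 2, 1:] * [:3:] -
    [:2 * \<delta> - 2 * ?\<mu> - 1, 2:] * [:3 * \<delta> - 2, 1:] * [:2:]"
  have "coeff q 2 = - 1" by (simp add: q_def numeral_2_eq_2)
  then have "q \<noteq> 0" by auto
  then have fin: "finite {z. poly q z = 0}" by (rule poly_roots_finite)
  \<comment> \<open>N = 0 and N = 1 are set aside: n (n - 1) vanishes there, and N - 2 would be
    truncated.\<close>
  define Z where "Z = insert 0 (insert 1 {z. poly q z = 0})"
  define J where "J = (\<lambda>z. p * (z + \<delta> - ?\<mu> - 1)) ` Z"
  have "finite J" using fin by (simp add: J_def Z_def)
  then have "finite (of_nat -` J :: nat set)" by (rule finite_vimageI) simp
  moreover have "of_nat j \<in> J"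
    if notin: "X j 0 low \<notin> P" and c: "X j 0 low - c *s (dd ^^ N) x \<in> P"
      and N: "of_nat N + \<delta> = ?\<mu> + (of_nat j / p + 1)" for j N c
  proof -
    have j: "of_nat j = p * (of_nat N + \<delta> - ?\<mu> - 1)"
      using N p_nonzero by (simp add: field_simps)
    have "of_nat N \<in> Z"
    proof (rule ccontr)
      assume "of_nat N \<notin> Z"
      then have q: "poly q (of_nat N) \<noteq> 0" and "N \<noteq> 0" "N \<noteq> 1" by (auto simp: Z_def)
      then obtain M where M: "N = Suc (Suc M)" by (metis not0_implies_Suc One_nat_def)
      define n :: complex where "n = of_nat N"
      have n: "n \<noteq> 0" "n - 1 \<noteq> 0"
        using \<open>N \<noteq> 0\<close> \<open>N \<noteq> 1\<close> unfolding n_def by simp_all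
      let ?w = "(dd ^^ M) x" and ?u = "X j 0 low - c *s (dd ^^ N) x"
      define a where "a = p * n * (2 * \<delta> + n - 1)"
      define a' where "a' = p * (n - 1) * (2 * \<delta> + n - 2)"
      define b where "b = p * n * (n - 1) * (n - 2 + 3 * \<delta>)"
      have e2: "X 0 2 ((dd ^^ N) x) - a *s (dd ^^ (N - 1)) x \<in> P"
        unfolding a_def n_def by (rule X_0_2_funpow_dd[OF P(1,2) x(1,2)])
      have e2': "X 0 2 ((dd ^^ (N - 1)) x) - a' *s ?w \<in> P"
        using X_0_2_funpow_dd[OF P(1,2) x(1,2), of "N - 1"] unfolding a'_def n_def M
        by (simp add: algebra_simps)
      have e3: "X 0 3 ((dd ^^ N) x) - b *s ?w \<in> P"
        using X_0_3_funpow_dd[OF P(1,2) x, of N] unfolding b_def n_def M by simp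
      have "X 0 2 (X 0 2 ((dd ^^ N) x) - a *s (dd ^^ (N - 1)) x)
          + a *s (X 0 2 ((dd ^^ (N - 1)) x) - a' *s ?w) \<in> P"
        by (intro subspace_add[OF P(1)] subspace_scale[OF P(1)] P(3) e2 e2')
      then have e22: "X 0 2 (X 0 2 ((dd ^^ N) x)) - (a * a') *s ?w \<in> P"
        by (simp add: X_simps algebra_simps)
      have "X 0 2 (X 0 2 ?u) + c *s (X 0 2 (X 0 2 ((dd ^^ N) x)) - (a * a') *s ?w) \<in> P"
        by (intro subspace_add[OF P(1)] subspace_scale[OF P(1)] P(3) e22 c)
      then have f2: "X 0 2 (X 0 2 (X j 0 low)) - (c * (a * a')) *s ?w \<in> P"
        by (simp add: X_simps algebra_simps)
      have "X 0 3 ?u + c *s (X 0 3 ((dd ^^ N) x) - b *s ?w) \<in> P"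
        by (intro subspace_add[OF P(1)] subspace_scale[OF P(1)] P(4) e3 c)
      then have f3: "X 0 3 (X j 0 low) - (c * b) *s ?w \<in> P"
        by (simp add: X_simps algebra_simps)
      let ?r = "2 * (2 * of_nat j + p)"
      have "?r *s (X 0 3 (X j 0 low) - (c * b) *s ?w)
          - 3 *s (X 0 2 (X 0 2 (X j 0 low)) - (c * (a * a')) *s ?w) \<in> P"
        by (intro subspace_diff[OF P(1)] subspace_scale[OF P(1)] f2 f3)
      then have g: "(c * (3 * (a * a') - ?r * b)) *s ?w \<in> P"
        by (simp add: X_j_0_low_relation algebra_simps)
      have "3 * (a * a') - ?r * b = p\<^sup>2 * (n * (n - 1)) * poly q n"
        unfolding a_def a'_def b_def q_def j n_def[symmetric]
        by (simp add: power2_eq_square algebra_simps)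
      then have "3 * (a * a') - ?r * b \<noteq> 0"
        using n q p_nonzero unfolding n_def by simp
      then have "(1 / (3 * (a * a') - ?r * b)) *s (c * (3 * (a * a') - ?r * b)) *s ?w = c *s ?w"
        by simp
      then have "c *s ?w \<in> P" using subspace_scale[OF P(1) g] by metis
      then have "dd (dd (c *s ?w)) \<in> P" by (intro P(2))
      then have "c *s (dd ^^ N) x \<in> P" by (simp add: M dd_simps)
      then have "?u + c *s (dd ^^ N) x \<in> P" by (rule subspace_add[OF P(1) c])
      then show False using notin by simp
    qed
    then show ?thesis unfolding J_def j by blast
  qed
  ultimately show ?thesis by (elim finite_subset[rotated]) auto
qed

lemma span_diff_scaleD: "x - c *s y \<in> span S \<Longrightarrow> y \<in> span S \<Longrightarrow> x \<in> span S"
  using span_add[OF _ span_scale, of "x - c *s y" S y c] by simp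

lemma orbit_X_0_stable:
  assumes "Q \<subseteq> gens" "\<And>s. s \<in> Q \<Longrightarrow> X 0 2 s \<in> span (orbit Q)"
    "\<And>s. s \<in> Q \<Longrightarrow> X 0 3 s \<in> span (orbit Q)" "v \<in> span (orbit Q)"
  shows "X 0 2 v \<in> span (orbit Q)" "X 0 3 v \<in> span (orbit Q)"
proof -
  have 2: "X 0 2 ((dd ^^ n) s) \<in> span (orbit Q)" if "s \<in> Q" for n s
  proof -
    have e: "euler s = wt s *s s" using that assms(1) by (intro euler_gens) auto
    have "X 0 2 ((dd ^^ n) s) - (p * of_nat n * (2 * wt s + of_nat n - 1)) *s (dd ^^ (n - 1)) s
        \<in> span (orbit Q)"
      using assms(2)[OF that] by (intro X_0_2_funpow_dd dd_orbit e subspace_span)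
    then show ?thesis using orbit_base[OF that] by (rule span_diff_scaleD)
  qed
  have 3: "X 0 3 ((dd ^^ n) s) \<in> span (orbit Q)" if "s \<in> Q" for n s
  proof -
    have e: "euler s = wt s *s s" using that assms(1) by (intro euler_gens) auto
    have "X 0 3 ((dd ^^ n) s) - (p * of_nat n * (of_nat n - 1) * (of_nat n - 2 + 3 * wt s)) *s
        (dd ^^ (n - 2)) s \<in> span (orbit Q)"
      using assms(2,3)[OF that] by (intro X_0_3_funpow_dd dd_orbit e subspace_span)
    then show ?thesis using orbit_base[OF that] by (rule span_diff_scaleD)
  qed
  show "X 0 2 v \<in> span (orbit Q)"
    using 2 by (intro span_stable[OF lin_X _ assms(4)]) (auto simp: orbit_def)
  show "X 0 3 v \<in> span (orbit Q)"
    using 3 by (intro span_stable[OF lin_X _ assms(4)]) (auto simp: orbit_def)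
qed

text \<open>For n >= 2 the mode \<open>X 0 n\<close> lowers the weight, so only generators strictly
  below x in real part can occur, and these lie in Q.\<close>

lemma lowered_generator:
  assumes "insert x Q \<subseteq> gens" "\<And>s. s \<in> gens \<Longrightarrow> Re (wt s) < Re (wt x) \<Longrightarrow> s \<in> Q" "n \<ge> 2"
  shows "X 0 n x \<in> span (orbit Q)"
proof -
  have "euler (X 0 n x) = (wt x + (of_nat 0 / p + 1 - of_nat n)) *s X 0 n x"
    using assms(1) by (intro euler_X_eigen euler_gens) auto
  then have "X 0 n x \<in> span {(dd ^^ k) s | k s. s \<in> gens \<and>
      of_nat k + wt s = wt x + (of_nat 0 / p + 1 - of_nat n)}"
    using gens(3) by (intro homogeneous_in_orbit) auto
  moreover have "{(dd ^^ k) s | k s. s \<in> gens \<and>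
      of_nat k + wt s = wt x + (of_nat 0 / p + 1 - of_nat n)} \<subseteq> orbit Q"
  proof
    fix y assume "y \<in> {(dd ^^ k) s | k s. s \<in> gens \<and>
      of_nat k + wt s = wt x + (of_nat 0 / p + 1 - of_nat n)}"
    then obtain k s where ks: "y = (dd ^^ k) s" "s \<in> gens"
      "of_nat k + wt s = wt x + (of_nat 0 / p + 1 - of_nat n)" by blast
    from arg_cong[OF ks(3), of Re] have "Re (wt s) < Re (wt x)" using assms(3) by simp
    then show "y \<in> orbit Q" using ks assms(2) unfolding orbit_def by blast
  qed
  ultimately show ?thesis using span_mono by blast
qed

text \<open>Generators are added by increasing real part of the weight. Each Q is then closed
  downwards, its span is stable under \<open>X 0 2\<close> and \<open>X 0 3\<close>, and
  \<open>flag_step\<close> excludes finitely many j; for the others \<open>X j 0 low\<close> drops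
  to the previous span.\<close>

lemma X_j_0_low_flag:
  assumes "finite Q"
  shows "Q \<subseteq> gens \<Longrightarrow> (\<And>s t. s \<in> gens \<Longrightarrow> t \<in> Q \<Longrightarrow> Re (wt s) < Re (wt t) \<Longrightarrow> s \<in> Q) \<Longrightarrow>
    \<exists>J. \<forall>j\<ge>J. X j 0 low \<in> span (orbit Q) \<longrightarrow> X j 0 low = 0"
  using assms
proof (induction Q rule: finite_ranking_induct[where f = "\<lambda>s. Re (wt s)"])
  case empty
  then show ?case by (simp add: orbit_def)
next
  case (insert x Q)
  have Q: "s \<in> Q" if "s \<in> gens" "t \<in> insert x Q" "Re (wt s) < Re (wt t)" for s t
    using insert.prems(2)[OF that] insert.hyps(2) that by force
  then obtain J where J: "\<And>j. j \<ge> J \<Longrightarrow> X j 0 low \<in> span (orbit Q) \<Longrightarrow> X j 0 low = 0"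
    using insert.IH insert.prems(1) by (metis insert_iff insert_subset)
  let ?P = "span (orbit Q)"
  let ?bad = "{j. \<exists>N c. X j 0 low \<notin> ?P \<and> X j 0 low - c *s (dd ^^ N) x \<in> ?P \<and>
    of_nat N + wt x = wt low + (of_nat j / p + 1)}"
  have lowered: "X 0 n s \<in> ?P" if "s \<in> insert x Q" "n \<ge> 2" for s n
    using that insert.prems(1) Q by (intro lowered_generator) auto
  have "finite ?bad"
  proof (rule flag_step)
    fix v assume v: "v \<in> ?P"
    show "dd v \<in> ?P" by (rule dd_orbit[OF v])
    show "X 0 2 v \<in> ?P" "X 0 3 v \<in> ?P"
      using lowered insert.prems(1) by (auto intro: orbit_X_0_stable[OF _ _ _ v])
  next
    show "euler x = wt x *s x" using insert.prems(1) by (intro euler_gens) auto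
  qed (use lowered in auto)
  then obtain K where K: "\<And>j. j \<in> ?bad \<Longrightarrow> j < K" by (meson finite_nat_set_iff_bounded)
  have "X j 0 low = 0" if j: "j \<ge> max J K" and in_orbit: "X j 0 low \<in> span (orbit (insert x Q))" for j
  proof -
    let ?\<nu> = "wt low + (of_nat j / p + 1)"
    have "euler (X j 0 low) = ?\<nu> *s X j 0 low"
      using euler_X_eigen[OF euler_low, of j 0] by simp
    then have "X j 0 low \<in> span {(dd ^^ n) s | n s. s \<in> insert x Q \<and> of_nat n + wt s = ?\<nu>}"
      (is "_ \<in> span ?S") using insert.prems(1) in_orbit by (intro homogeneous_in_orbit)
    moreover have "?S \<subseteq> orbit Q \<union> {(dd ^^ n) x | n. of_nat n + wt x = ?\<nu>}"
      unfolding orbit_def by blast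
    ultimately have mem: "X j 0 low \<in> span (orbit Q \<union> {(dd ^^ n) x | n. of_nat n + wt x = ?\<nu>})"
      using span_mono by blast
    have "X j 0 low \<in> ?P"
    proof (cases "\<exists>N. of_nat N + wt x = ?\<nu>")
      case True
      then obtain N where N: "of_nat N + wt x = ?\<nu>" by blast
      \<comment> \<open>The weight fixes the exponent, so at most one power of \<open>dd\<close> on
        x contributes.\<close>
      then have "n = N" if "of_nat n + wt x = ?\<nu>" for n
        using that by (metis add_right_cancel of_nat_eq_iff)
      then have "{(dd ^^ n) x | n. of_nat n + wt x = ?\<nu>} = {(dd ^^ N) x}" using N by blast
      then have "X j 0 low \<in> span (insert ((dd ^^ N) x) (orbit Q))" using mem by simp
      then obtain c where c: "X j 0 low - c *s (dd ^^ N) x \<in> ?P" by (auto simp: span_breakdown_eq)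
      show ?thesis
      proof (rule ccontr)
        assume "X j 0 low \<notin> ?P"
        then have "j \<in> ?bad" using c N by blast
        then show False using K[of j] j by simp
      qed
    next
      case False
      then show ?thesis using mem by simp
    qed
    then show ?thesis using J j by simp
  qed
  then show ?case by blast
qed

text \<open>\<open>X 0 2\<close> carries \<open>X j m low\<close> to a multiple of
  \<open>X j (m + 1) low\<close>. If the factor 2 (j + p) - m p vanishes, \<open>X 0 3\<close>
  reaches the same vector from index m - 1 with the factor p (m + 2) / 2.\<close>

lemma X_low_eq_0_if_lowest:
  assumes "X j 0 low = 0" "of_nat j + p \<noteq> 0"
  shows "X j n low = 0"
proof (induction n rule: less_induct)
  case (less n)
  show ?case
  proof (cases n)
    case 0
    then show ?thesis using assms by simp
  next
    case (Suc m)
    have 2: "(2 * (of_nat j + p) - of_nat m * p) *s X j n low = 0"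
      using X_comm[of 0 2 j m low] less[of m] by (simp add: X_0_low_eq_0 X_simps Suc)
    show ?thesis
    proof (cases "2 * (of_nat j + p) = of_nat m * p")
      case True
      have "2 * (of_nat j + p) \<noteq> 0" using assms(2) by (simp only: mult_eq_0_iff) simp
      then have "m \<noteq> 0" using True by (metis mult_zero_left of_nat_0)
      then obtain l where l: "m = Suc l" by (cases m) auto
      have "(3 * (of_nat j + p) - of_nat l * p) *s X j n low = 0"
        using X_comm[of 0 3 j l low] less[of l] by (simp add: X_0_low_eq_0 X_simps Suc l)
      moreover have "3 * (of_nat j + p) - of_nat l * p = p * of_nat (l + 3) / 2"
      proof -
        have "3 * (of_nat j + p) = 3 / 2 * (of_nat m * p)"
          unfolding True[symmetric] by (simp add: field_simps)
        then show ?thesis by (simp add: l field_simps)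
      qed
      ultimately have "(p * of_nat (l + 3) / 2) *s X j n low = 0" by (simp only:)
      then show ?thesis using p_nonzero by (simp del: of_nat_add)
    next
      case False
      then show ?thesis using 2 by simp
    qed
  qed
qed

text \<open>Brackets never lower the index, so the vectors killed by all L_j with j >= J form a
  submodule, and testing on \<open>low\<close> is enough.\<close>

lemma X_eventually_0: "\<exists>J. \<forall>j\<ge>J. \<forall>n v. X j n v = 0"
proof -
  obtain J0 where J0: "\<And>j. j \<ge> J0 \<Longrightarrow> X j 0 low = 0"
    using X_j_0_low_flag[OF gens(1)] gens(3) by auto
  obtain K :: nat where K: "real K > norm p" using reals_Archimedean2 by blast
  have ne: "of_nat j + p \<noteq> 0" if "j \<ge> K" for j
  proof
    assume "of_nat j + p = 0"
    then have "norm p = norm (of_nat j :: complex)"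
      by (metis add_eq_0_iff norm_minus_cancel)
    then show False using that K by simp
  qed
  let ?J = "max J0 K"
  have low: "\<forall>j\<ge>?J. \<forall>n. X j n low = 0"
    using X_low_eq_0_if_lowest J0 ne by simp
  have "v \<in> {v. \<forall>j\<ge>?J. \<forall>n. X j n v = 0}" for v
  proof (rule submodule_UNIV[of _ low])
    show "X i m w \<in> {v. \<forall>j\<ge>?J. \<forall>n. X j n v = 0}" if "w \<in> {v. \<forall>j\<ge>?J. \<forall>n. X j n v = 0}" for i m w
      using that X_comm[of _ _ i m w] by (simp add: X_simps)
  qed (use low low_nonzero in \<open>auto simp: X_simps X_D D_simps intro!: subspaceI\<close>)
  then show ?thesis by blast
qed

section \<open>The top nonzero mode\<close>

text \<open>Y moves Euler weights by b, so its iterates on an eigenvector must reach zero in W; the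
  last nonzero one is homogeneous and lies in the kernel.\<close>

lemma shift_kernel:
  assumes W: "fdim W" "subspace W" "euler ` W \<subseteq> W" "v \<in> W" "v \<noteq> 0"
    and Y: "Y ` W \<subseteq> W" "\<And>v. euler (Y v) = Y (euler v) + b *s Y v" "b \<noteq> 0" "lin Y"
  obtains u \<mu> where "u \<in> W" "u \<noteq> 0" "Y u = 0" "euler u = \<mu> *s u"
proof -
  obtain w \<mu> where w: "w \<in> W" "w \<noteq> 0" "euler w = \<mu> *s w"
    using W(4,5) by (rule fdim_eigenvector[OF W(1) lin_euler W(2,3)])
  have in_W: "(Y ^^ k) w \<in> W" for k by (induction k) (use w Y(1) in auto)
  have e: "euler ((Y ^^ k) w) = (\<mu> + of_nat k * b) *s (Y ^^ k) w" for k
  proof (induction k)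
    case (Suc k)
    then show ?case by (simp add: Y(2) lin_simps[OF Y(4)] algebra_simps)
  qed (use w in simp)
  have "\<exists>k. (Y ^^ k) w = 0"
    by (rule fdim_eigenvalue_progression[OF W(1) lin_euler in_W e Y(3)])
  then have k: "(Y ^^ (LEAST k. (Y ^^ k) w = 0)) w = 0" by (rule LeastI_ex)
  then obtain l where l: "(LEAST k. (Y ^^ k) w = 0) = Suc l"
    using w(2) by (cases "LEAST k. (Y ^^ k) w = 0") auto
  have "(Y ^^ l) w \<noteq> 0"
    using l not_less_Least[of l "\<lambda>k. (Y ^^ k) w = 0"] by auto
  moreover have "Y ((Y ^^ l) w) = 0" using k l by simp
  ultimately show ?thesis using that in_W e by blast
qed

text \<open>The common kernel of the modes of index j is a submodule: brackets with index 0 stay at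
  j, and those with larger index land above j and vanish.\<close>

lemma top_faithful:
  assumes ne: "X j n0 v0 \<noteq> 0" and top: "\<And>k n v. k > j \<Longrightarrow> X k n v = 0"
    and v: "\<And>n. X j n v = 0"
  shows "v = 0"
proof (rule ccontr)
  assume v0: "v \<noteq> 0"
  have "v0 \<in> {v. \<forall>n. X j n v = 0}"
  proof (rule submodule_UNIV[of _ v])
    show "X i m w \<in> {v. \<forall>n. X j n v = 0}" if "w \<in> {v. \<forall>n. X j n v = 0}" for i m w
    proof (cases "i = 0")
      case True
      then show ?thesis using that X_comm[of j _ 0 m w] by (simp add: X_simps)
    next
      case False
      then show ?thesis using that X_comm[of j _ i m w] top[of "j + i"] by (simp add: X_simps)
    qed
  qed (use v v0 in \<open>auto simp: X_simps X_D D_simps intro!: subspaceI\<close>)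
  then show False using ne by simp
qed

text \<open>Modes of index j with nonzero degree, k \<noteq> j/p + 1, have kernels on the cutoff
  space. Passing to these kernels one at a time leaves a nonzero space, stable because the modes
  commute. Faithfulness then forces a mode of degree zero to exist, so j/p + 1 is a natural
  number.\<close>

lemma top_weight_vector:
  assumes j: "j \<ge> 1" and ne: "X j n0 v0 \<noteq> 0" and top: "\<And>k n v. k > j \<Longrightarrow> X k n v = 0"
  obtains m w c \<mu> where "of_nat m = of_nat j / p + 1" "w \<noteq> 0" "euler w = \<mu> *s w"
    "X j m w = c *s w" "c \<noteq> 0" "\<And>k. k \<noteq> m \<Longrightarrow> X j k w = 0"
proof -
  have v0: "v0 \<noteq> 0" using ne by (auto simp: X_simps)
  have comm: "X j m (X j n v) = X j n (X j m v)" for m n v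
    using X_comm[of j m j n v] top[of "j + j"] j by simp
  have faithful: "v = 0" if "\<And>n. X j n v = 0" for v
    using ne top that by (rule top_faithful)
  obtain N where N: "\<forall>k\<ge>N. X j k v0 = 0" using X_finite by blast
  define V where "V = {v. \<forall>k\<ge>N. X j k v = 0}"
  have fV: "fdim V" unfolding V_def by (rule X_cutoff_fdim[OF faithful])
  let ?a = "of_nat j / p + 1"
  have "\<exists>W. subspace W \<and> W \<subseteq> V \<and> euler ` W \<subseteq> W \<and> (\<forall>k. X j k ` W \<subseteq> W) \<and> (\<exists>w\<in>W. w \<noteq> 0) \<and>
      (\<forall>k<m. of_nat k \<noteq> ?a \<longrightarrow> (\<forall>w\<in>W. X j k w = 0))" for m
  proof (induction m)
    case 0
    have "X j k (euler w) = 0" if "w \<in> V" "k \<ge> N" for w k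
      using euler_X[of j k w] that by (simp add: euler_simps V_def)
    then have "euler ` V \<subseteq> V" by (auto simp: V_def)
    moreover have "X j k ` V \<subseteq> V" for k using comm[of _ k] by (auto simp: V_def X_simps)
    moreover have "subspace V" unfolding V_def by (rule subspaceI) (auto simp: X_simps)
    ultimately show ?case using N v0 by (intro exI[of _ V]) (auto simp: V_def)
  next
    case (Suc m)
    then obtain W where W: "subspace W" "W \<subseteq> V" "euler ` W \<subseteq> W" "\<forall>k. X j k ` W \<subseteq> W"
      "\<exists>w\<in>W. w \<noteq> 0" "\<forall>k<m. of_nat k \<noteq> ?a \<longrightarrow> (\<forall>w\<in>W. X j k w = 0)" by blast
    show ?case
    proof (cases "of_nat m = ?a")
      case True
      then show ?thesis using W by (intro exI[of _ W]) (auto simp: less_Suc_eq)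
    next
      case False
      let ?W = "{w \<in> W. X j m w = 0}"
      obtain v where v: "v \<in> W" "v \<noteq> 0" using W(5) by blast
      obtain u \<mu> where u: "u \<in> W" "u \<noteq> 0" "X j m u = 0" "euler u = \<mu> *s u"
        using shift_kernel[OF fdim_subset[OF fV W(2)] W(1,3) v, of "X j m"] W(4) euler_X False
          lin_X by (metis right_minus_eq)
      have "X j m (euler w) = 0" if "X j m w = 0" for w
        using euler_X[of j m w] that by (simp add: euler_simps)
      moreover have "subspace ?W"
        using W(1) by (auto intro!: subspaceI simp: X_simps subspace_0 subspace_add subspace_scale)
      moreover have "X j m (X j k w) = 0" if "X j m w = 0" for k w
        using comm[of m k w] that by (simp add: X_simps)
      ultimately show ?thesis using W u by (intro exI[of _ ?W]) (auto simp: less_Suc_eq image_subset_iff)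
    qed
  qed
  from this[of N] obtain W where W: "subspace W" "W \<subseteq> V" "euler ` W \<subseteq> W" "\<forall>k. X j k ` W \<subseteq> W"
    "\<exists>w\<in>W. w \<noteq> 0" "\<forall>k<N. of_nat k \<noteq> ?a \<longrightarrow> (\<forall>w\<in>W. X j k w = 0)" by blast
  have zero: "X j k w = 0" if "w \<in> W" "of_nat k \<noteq> ?a" for k w
    using W(2,6) that by (cases "k < N") (auto simp: V_def)
  have fW: "fdim W" by (rule fdim_subset[OF fV W(2)])
  obtain v where v: "v \<in> W" "v \<noteq> 0" using W(5) by blast
  then obtain m where m: "of_nat m = ?a" using zero faithful by metis
  obtain u \<mu> where u: "u \<in> W" "u \<noteq> 0" "euler u = \<mu> *s u"
    using v by (rule fdim_eigenvector[OF fW lin_euler W(1,3)])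
  \<comment> \<open>The mode of degree zero preserves each Euler eigenspace, hence has an
    eigenvector of definite weight.\<close>
  let ?U = "{w \<in> W. euler w = \<mu> *s w}"
  have U: "fdim ?U" by (rule fdim_subset[OF fW]) auto
  have subU: "subspace ?U"
    using W(1) by (auto intro!: subspaceI simp: euler_simps subspace_0 subspace_add subspace_scale algebra_simps)
  have stU: "X j m ` ?U \<subseteq> ?U"
    using W(4) euler_X[of j m] m by (auto simp: X_simps)
  have "u \<in> ?U" using u by simp
  then obtain w c where w: "w \<in> ?U" "w \<noteq> 0" "X j m w = c *s w"
    using u(2) by (rule fdim_eigenvector[OF U lin_X subU stU])
  have k: "X j k w = 0" if "k \<noteq> m" for k
    using that m w zero by (metis (no_types, lifting) mem_Collect_eq of_nat_eq_iff)
  have "c \<noteq> 0"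
  proof
    assume "c = 0"
    then have "X j k w = 0" for k using k w(3) by (cases "k = m") auto
    then show False using faithful w(2) by blast
  qed
  then show ?thesis using that[OF m w(2) _ w(3)] w(1) k by blast
qed

text \<open>If m = l + 1, the commutator of \<open>X j l\<close> and \<open>X 0 2\<close> is a
  multiple of \<open>X j m\<close>, a nonzero scalar on the \<open>X 0 2\<close>-orbit of w, while
  \<open>X 0 2\<close> is nilpotent on w because weights are bounded below. So m = 0, j + p = m p =
  0, and \<open>X j 0\<close> becomes central.\<close>

lemma top_scalar:
  assumes j: "j \<ge> 1" and ne: "X j n0 v0 \<noteq> 0" and top: "\<And>k n v. k > j \<Longrightarrow> X k n v = 0"
  obtains c where "of_nat j + p = 0" "c \<noteq> 0" "\<And>v. X j 0 v = c *s v"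
proof -
  obtain m w c \<mu> where m: "of_nat m = of_nat j / p + 1" and w: "w \<noteq> 0" "euler w = \<mu> *s w"
    "X j m w = c *s w" and c: "c \<noteq> 0" and k: "\<And>k. k \<noteq> m \<Longrightarrow> X j k w = 0"
    using top_weight_vector[OF j ne top] by metis
  have jp: "of_nat j + p = of_nat m * p" using m p_nonzero by (simp add: field_simps)
  have X2: "X j n (X 0 2 z) = X 0 2 (X j n z) - (2 * (of_nat j + p) - of_nat n * p) *s X j (Suc n) z" for n z
    using X_comm[of 0 2 j n z] by simp
  have "m = 0"
  proof (rule ccontr)
    assume "m \<noteq> 0"
    then obtain l where l: "m = Suc l" by (cases m) auto
    let ?x = "X 0 2"
    \<comment> \<open>Moving \<open>X j n\<close> past \<open>X 0 2\<close> only produces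
      \<open>X j (n + 1)\<close>: modes above m keep killing the orbit of w, and
      \<open>X j m\<close> keeps acting on it as c.\<close>
    have hi: "X j n ((?x ^^ k) w) = 0" if "n > m" for n k
      using that by (induction k arbitrary: n) (simp_all add: k X2 X_simps)
    have mid: "X j m ((?x ^^ k) w) = c *s (?x ^^ k) w" for k
      by (induction k) (simp_all add: w X2 hi X_simps)
    show False
    proof (rule heisenberg_contradiction[of ?x w "X j l" "- ((of_nat m + 1) * p * c)"])
      show "\<exists>k. (?x ^^ k) w = 0" by (rule X_0_nilpotent[OF w(2)])
      show "X j l w = 0" using l k by simp
      have "of_nat m + 1 \<noteq> (0 :: complex)" by (metis of_nat_Suc of_nat_neq_0 add.commute)
      then show "- ((of_nat m + 1) * p * c) \<noteq> 0" using p_nonzero c by simp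
      show "X j l ((?x ^^ Suc k) w) = ?x (X j l ((?x ^^ k) w)) + (- ((of_nat m + 1) * p * c)) *s (?x ^^ k) w" for k
      proof -
        have "2 * (of_nat j + p) - of_nat l * p = (of_nat m + 1) * p"
          unfolding jp by (simp add: l algebra_simps)
        then show ?thesis using X2[of l "(?x ^^ k) w"] mid[of k] l by simp
      qed
    qed (simp_all add: w lin_X)
  qed
  then have jp0: "of_nat j + p = 0" using jp by simp
  have "X j 0 v = c *s v" for v
  proof (rule schur[OF lin_X _ _ w(1)])
    show "X j 0 (X i n v) = X i n (X j 0 v)" for i n v
      using X_comm[of j 0 i n v] jp0 by simp
    show "X j 0 w = c *s w" using w \<open>m = 0\<close> by simp
  qed (simp add: X_D)
  then show ?thesis using that jp0 c by blast
qed

text \<open>For j = k + 1 with k >= 1, \<open>X 1 0\<close> and \<open>X k 1\<close> have commutator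
  k times the scalar \<open>X j 0\<close>. Their degrees -k/p and k/p are nonzero, so on V the first
  has a homogeneous kernel vector and the second is nilpotent on it. For j = 1 the factor k would be
  0.\<close>

lemma top_eq_1:
  assumes j: "j \<ge> 1" and ne: "X j n0 v0 \<noteq> 0" and top: "\<And>k n v. k > j \<Longrightarrow> X k n v = 0"
  shows "j = 1"
proof (rule ccontr)
  assume j1: "j \<noteq> 1"
  obtain c where jp: "of_nat j + p = 0" and c: "c \<noteq> 0" "\<And>v. X j 0 v = c *s v"
    using top_scalar[OF j ne top] by metis
  obtain k where k: "j = Suc k" "k \<ge> 1" using j j1 by (cases j) auto
  have p: "p = - 1 - of_nat k" using jp k by (simp add: algebra_simps eq_neg_iff_add_eq_0)
  obtain N where N: "\<forall>n\<ge>N. X j n v0 = 0" using X_finite by blast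
  define V where "V = {v. \<forall>n\<ge>N. X j n v = 0}"
  have fV: "fdim V" unfolding V_def
    by (rule X_cutoff_fdim) (rule top_faithful[OF ne top])
  have v0: "v0 \<in> V" "v0 \<noteq> 0" using N ne by (auto simp: V_def X_simps)
  have stable: "X i m ` V \<subseteq> V" if "i \<ge> 1" for i m
    using that X_comm[of j _ i m] top[of "j + i"] by (auto simp: V_def X_simps)
  have "X j k (euler w) = 0" if "w \<in> V" "k \<ge> N" for w k
    using euler_X[of j k w] that by (simp add: euler_simps V_def)
  then have eV: "euler ` V \<subseteq> V" by (auto simp: V_def)
  have subV: "subspace V" unfolding V_def by (rule subspaceI) (auto simp: X_simps)
  have b: "of_nat 1 / p + 1 - of_nat 0 \<noteq> 0"
  proof -
    have "of_nat 1 / p + 1 - of_nat 0 = (1 + p) / p" using p_nonzero by (simp add: field_simps)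
    also have "\<dots> = - of_nat k / p" using p by simp
    finally show ?thesis using k p_nonzero by simp
  qed
  obtain u \<mu> where u: "u \<in> V" "u \<noteq> 0" "X 1 0 u = 0" "euler u = \<mu> *s u"
    using shift_kernel[OF fV subV eV v0, of "X 1 0"] stable[of 1] euler_X b lin_X by (metis order_refl)
  let ?x = "X k 1"
  have in_V: "(?x ^^ n) u \<in> V" for n by (induction n) (use u stable[OF k(2)] in auto)
  have e: "euler ((?x ^^ n) u) = (\<mu> + of_nat n * (of_nat k / p)) *s (?x ^^ n) u" for n
  proof (induction n)
    case (Suc n)
    show ?case using euler_X_eigen[OF Suc, of k 1] by (simp add: algebra_simps add_divide_distrib)
  qed (use u in simp)
  have nil: "\<exists>n. (?x ^^ n) u = 0"
    using k p_nonzero by (intro fdim_eigenvalue_progression[OF fV lin_euler in_V e]) auto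
  have step: "X 1 0 ((?x ^^ Suc n) u) = ?x (X 1 0 ((?x ^^ n) u)) + (of_nat k * c) *s (?x ^^ n) u" for n
    using X_comm[of k 1 1 0 "(?x ^^ n) u"] c(2) p k(1) by (simp add: algebra_simps)
  show False
    using heisenberg_contradiction[OF lin_X u(2,3) _ nil lin_X step] k c by simp
qed

lemma X_higher_eq_0:
  assumes "j \<ge> 1" "j \<noteq> 1 \<or> p \<noteq> - 1"
  shows "X j n v = 0"
proof (rule ccontr)
  assume ne: "X j n v \<noteq> 0"
  obtain J where J: "\<forall>j\<ge>J. \<forall>n v. X j n v = 0" using X_eventually_0 by blast
  define M where "M = {i. i \<ge> 1 \<and> (\<exists>n v. X i n v \<noteq> 0)}"
  have "M \<subseteq> {..<J}" using J unfolding M_def by (auto simp: not_le[symmetric])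
  then have fin: "finite M" using finite_subset by blast
  have jM: "j \<in> M" using assms(1) ne by (auto simp: M_def)
  then have "Max M \<in> M" using fin Max_in by blast
  then obtain n0 v0 where top: "Max M \<ge> 1" "X (Max M) n0 v0 \<noteq> 0" by (auto simp: M_def)
  have above: "X k n v = 0" if "k > Max M" for k n v
    using Max_ge[OF fin, of k] that top(1) by (force simp: M_def)
  have "Max M = 1" by (rule top_eq_1[OF top above])
  moreover have "of_nat (Max M) + p = 0" using top_scalar[OF top above] by metis
  moreover have "j \<le> Max M" using jM fin by simp
  ultimately show False using assms by (auto simp: add_eq_0_iff)
qed

lemma X_1_scalar: "\<exists>\<beta>. \<forall>v. X 1 0 v = \<beta> *s v"
proof (cases "\<exists>n v. X 1 n v \<noteq> 0")
  case True
  then obtain n v where ne: "X 1 n v \<noteq> 0" by blast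
  have "X k n v = 0" if "k > 1" for k n v using that by (intro X_higher_eq_0) auto
  from top_scalar[OF _ ne this] show ?thesis by (metis order_refl)
next
  case False
  then show ?thesis by (intro exI[of _ 0]) simp
qed

section \<open>Generation by a lowest weight vector\<close>

lemma generated_by:
  assumes w: "w \<noteq> 0" "\<And>i n. \<exists>f. X i n w = polyD sc D f w"
  shows "\<exists>f. v = polyD sc D f w"
proof -
  let ?V = "range (\<lambda>f. polyD sc D f w)"
  have sub: "subspace ?V"
  proof (rule subspaceI)
    show "0 \<in> ?V" by (rule image_eqI[of _ _ 0]) simp_all
    show "x + y \<in> ?V" if "x \<in> ?V" "y \<in> ?V" for x y
      using that by (auto simp: polyD_add[symmetric])
    show "c *s x \<in> ?V" if "x \<in> ?V" for c x
      using that by (auto simp: polyD_smult[symmetric])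
  qed
  have D: "D x \<in> ?V" if "x \<in> ?V" for x
  proof -
    obtain f where f: "x = polyD sc D f w" using \<open>x \<in> ?V\<close> by blast
    show ?thesis by (rule image_eqI[of _ _ "pCons 0 f"]) (simp_all add: f polyD_pCons[OF lin_D])
  qed
  have "X i n (polyD sc D f w) \<in> ?V" for i n f
  proof (induction f arbitrary: n)
    case 0
    then show ?case using subspace_0[OF sub] by (simp add: X_simps)
  next
    case (pCons a f)
    have "X i n w \<in> ?V" using w(2) by blast
    then have "a *s X i n w + (D (X i n (polyD sc D f w)) + of_nat n *s X i (n - 1) (polyD sc D f w)) \<in> ?V"
      using pCons D by (intro subspace_add[OF sub] subspace_scale[OF sub]) auto
    then show ?case by (simp add: polyD_pCons[OF lin_D] X_simps X_D)
  qed
  then have X: "X i n x \<in> ?V" if "x \<in> ?V" for i n x using that by blast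
  have "w \<in> ?V" by (rule image_eqI[of _ _ "[:1:]"]) simp_all
  then have "v \<in> ?V" using submodule_UNIV[of ?V w v] sub D X w(1) by blast
  then show ?thesis by blast
qed

lemma polyD_linear_alpha: "polyD sc D [:alpha, 1:] v = dd v"
  by (simp add: polyD_pCons[OF lin_D] dd_def D_simps algebra_simps)

text \<open>At p = -1 the mode \<open>X 1 n\<close> has degree -n, so it leads below the lowest
  weight; for other p it vanishes identically.\<close>

lemma X_1_low:
  assumes "n \<ge> 1"
  shows "X 1 n low = 0"
proof (cases "p = - 1")
  case True
  show ?thesis by (rule X_low_eq_0) (use True assms in simp)
next
  case False
  then show ?thesis by (simp add: X_higher_eq_0)
qed

lemma low_generates:
  "\<exists>f. v = polyD sc D f low"
proof (rule generated_by[OF low_nonzero])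
  obtain \<beta> where \<beta>: "\<And>v. X 1 0 v = \<beta> *s v" using X_1_scalar by blast
  fix i n :: nat
  consider "i = 0" "n = 0" | "i = 0" "n = 1" | "i = 0" "n \<ge> 2" | "i = 1" "n = 0" | "i = 1" "n \<ge> 1" | "i \<ge> 2"
    by linarith
  then show "\<exists>f. X i n low = polyD sc D f low"
  proof cases
    case 1
    then show ?thesis
      by (intro exI[of _ "smult p [:alpha, 1:]"]) (simp only: X_0_0 polyD_smult polyD_linear_alpha)
  next
    case 2
    then show ?thesis
      using X_0_1[of low] euler_low by (intro exI[of _ "[:p * wt low:]"]) simp
  next
    case 3
    then show ?thesis by (intro exI[of _ 0]) (simp add: X_0_low_eq_0)
  next
    case 4
    then show ?thesis using \<beta> by (intro exI[of _ "[:\<beta>:]"]) simp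
  next
    case 5
    then show ?thesis using X_1_low by (intro exI[of _ 0]) simp
  next
    case 6
    then show ?thesis using X_higher_eq_0 by (intro exI[of _ 0]) simp
  qed
qed

text \<open>If \<open>low\<close> has weight \<open>0\<close> and all higher modes vanish, then \<open>dd low\<close> is singular as well and
  would generate the module.\<close>

lemma wt_low_nonzero:
  assumes "\<And>v. X 1 0 v = 0"
  shows "wt low \<noteq> 0"
proof
  assume wt: "wt low = 0"
  have e: "euler low = 0" using euler_low wt by simp
  have ed: "euler (dd low) = dd low" by (simp add: euler_dd e dd_simps)
  have "\<exists>f. X i n (dd low) = polyD sc D f (dd low)" for i n :: nat
  proof -
    consider "i = 0" "n = 0" | "i = 0" "n = 1" | "i = 0" "n \<ge> 2" | "i = 1" "n = 0" | "i = 1" "n \<ge> 1" | "i \<ge> 2"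
      by linarith
    then show ?thesis
    proof cases
      case 1
      then show ?thesis
        by (intro exI[of _ "smult p [:alpha, 1:]"]) (simp only: X_0_0 polyD_smult polyD_linear_alpha)
    next
      case 2
      then show ?thesis
        using X_0_1[of "dd low"] ed by (intro exI[of _ "[:p:]"]) simp
    next
      case 3
      \<comment> \<open>For n = 2 this is \<open>X 0 1 low\<close>, zero because the weight is
        0.\<close>
      have "X 0 (n - 1) low = 0"
        using 3 X_0_low_eq_0[of "n - 1"] X_0_1[of low] e by (cases "n = 2") auto
      then show ?thesis using 3 by (intro exI[of _ 0]) (simp add: X_dd X_0_low_eq_0 dd_simps)
    next
      case 4
      then show ?thesis using assms by (intro exI[of _ 0]) simp
    next
      case 5
      have "X 1 (n - 1) low = 0" using assms X_1_low[of "n - 1"] by (cases "n = 1") (use 5 in auto)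
      then show ?thesis using X_1_low[of n] 5 by (intro exI[of _ 0]) (simp add: X_dd dd_simps)
    next
      case 6
      then show ?thesis using X_higher_eq_0 by (intro exI[of _ 0]) simp
    qed
  qed
  moreover have "dd low \<noteq> 0" using low_nonzero dd_eq_0 by blast
  ultimately obtain f where f: "low = polyD sc D f (dd low)" using generated_by by blast
  \<comment> \<open>C[\<partial>] acts freely on \<open>low\<close>, so f times the linear
    polynomial of \<open>dd\<close> would be 1, making that polynomial a unit.\<close>
  have "polyD sc D (f * [:alpha, 1:]) low = low"
    by (simp only: polyD_mult[OF lin_D] polyD_linear_alpha f[symmetric])
  moreover have "polyD sc D 1 low = low"
    using polyD_const[of D 1 low] by (simp add: one_pCons)
  ultimately have "polyD sc D (f * [:alpha, 1:] + smult (- 1) 1) low = 0"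
    by (simp only: polyD_add polyD_smult) simp
  then have "f * [:alpha, 1:] + smult (- 1) 1 = 0"
    using torsion_free low_nonzero by blast
  then have "f * [:alpha, 1:] = - smult (- 1) 1" by (simp only: eq_neg_iff_add_eq_0)
  then have "1 = [:alpha, 1:] * f" by (simp only: mult.commute) simp
  then have "[:alpha, 1:] dvd 1" by (rule dvdI)
  then show False by (simp add: is_unit_iff_degree)
qed

end

section \<open>From \<open>\<lambda>\<close>-brackets to modes\<close>

context complex_space
begin

text \<open>Replacing z by 2 z and subtracting a power of 2 times the original relation removes the
  top coefficient and scales the others by nonzero numbers.\<close>

lemma vector_poly_eq_0:
  assumes "\<And>z. (\<Sum>k\<le>n. z ^ k *s u k) = 0" "k \<le> n"
  shows "u k = 0"
  using assms
proof (induction n arbitrary: u k)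
  case 0
  from "0.prems"(1)[of 1] "0.prems"(2) show ?case by simp
next
  case (Suc n)
  have *: "u k = 0" if k: "k \<le> n" for k
  proof -
    have "(\<Sum>k\<le>n. z ^ k *s ((2 ^ k - 2 ^ Suc n) *s u k)) = 0" for z
    proof -
      have "(\<Sum>k\<le>Suc n. (2 * z) ^ k *s u k) - 2 ^ Suc n *s (\<Sum>k\<le>Suc n. z ^ k *s u k) = 0"
        using Suc.prems(1)[of z] Suc.prems(1)[of "2 * z"] by (simp only:) simp
      moreover have "(\<Sum>k\<le>Suc n. (2 * z) ^ k *s u k) - 2 ^ Suc n *s (\<Sum>k\<le>Suc n. z ^ k *s u k) =
          (\<Sum>k\<le>Suc n. z ^ k *s ((2 ^ k - 2 ^ Suc n) *s u k))"
        unfolding scale_sum_right sum_subtractf[symmetric]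
        by (intro sum.cong) (simp_all add: power_mult_distrib algebra_simps)
      ultimately show ?thesis by simp
    qed
    then have "(2 ^ k - 2 ^ Suc n) *s u k = 0" by (rule Suc.IH[OF _ k])
    moreover have "(2 :: complex) ^ k \<noteq> 2 ^ Suc n"
    proof
      assume "(2 :: complex) ^ k = 2 ^ Suc n"
      then have "of_nat (2 ^ k) = (of_nat (2 ^ Suc n) :: complex)" by simp
      then have "(2 :: nat) ^ k = 2 ^ Suc n" by (rule of_nat_eq_iff[THEN iffD1])
      then have "k = Suc n" by (simp only: power_inject_exp)
      then show False using k by simp
    qed
    ultimately show ?thesis by simp
  qed
  have "(\<Sum>k\<le>Suc n. 1 ^ k *s u k) = 0" by (rule Suc.prems(1))
  then have "u (Suc n) = 0" using * by simp
  then show ?case using * Suc.prems(2) by (cases "k = Suc n") auto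
qed

lemma vector_poly2_eq_0:
  assumes "\<And>l m. (\<Sum>a\<le>N. \<Sum>b\<le>N. (l ^ a * m ^ b) *s u a b) = 0" "a \<le> N" "b \<le> N"
  shows "u a b = 0"
proof (rule vector_poly_eq_0[OF _ assms(3)])
  fix m
  have "(\<Sum>a\<le>N. l ^ a *s (\<Sum>b\<le>N. m ^ b *s u a b)) = 0" for l
    using assms(1)[of l m] by (simp add: scale_sum_right)
  then show "(\<Sum>b\<le>N. m ^ b *s u a b) = 0"
    by (rule vector_poly_eq_0[OF _ assms(2)])
qed

text \<open>The triangle a + b \<le> K may grow to any rectangle containing it, as w vanishes beyond
  K. Two separate bounds are kept because a later factor l or m shifts only one index.\<close>

lemma binomial_sum:
  assumes "\<And>k. k > K \<Longrightarrow> w k = 0" "K \<le> M" "K \<le> N"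
  shows "(\<Sum>k\<le>K. (l + m) ^ k *s w k) =
    (\<Sum>a\<le>M. \<Sum>b\<le>N. (l ^ a * m ^ b * of_nat ((a + b) choose a)) *s w (a + b))"
proof -
  let ?g = "\<lambda>a b. (l ^ a * m ^ b * of_nat ((a + b) choose a)) *s w (a + b)"
  have "(\<Sum>k\<le>K. (l + m) ^ k *s w k) = (\<Sum>k\<le>K. \<Sum>a\<le>k. ?g a (k - a))"
    by (intro sum.cong) (simp_all add: binomial_ring scale_sum_left mult.commute mult.left_commute)
  also have "\<dots> = (\<Sum>(a, b)\<in>{(a, b). a + b \<le> K}. ?g a b)"
    by (rule sum.triangle_reindex_eq[symmetric])
  also have "\<dots> = (\<Sum>(a, b)\<in>{..M} \<times> {..N}. ?g a b)"
  proof -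
    have "k \<le> K" if "w k \<noteq> 0" for k using assms(1) that not_le by blast
    then show ?thesis using assms(2,3) by (intro sum.mono_neutral_left) auto
  qed
  also have "\<dots> = (\<Sum>a\<le>M. \<Sum>b\<le>N. ?g a b)" by (rule sum.cartesian_product[symmetric])
  finally show ?thesis .
qed

lemma peval_eq: "degree P \<le> n \<Longrightarrow> peval sc P z = (\<Sum>k\<le>n. z ^ k *s coeff P k)"
  unfolding peval_def by (intro sum.mono_neutral_left) (auto simp: coeff_eq_0)

end

lemma fact_mult_binomial: "fact m * fact n * of_nat ((m + n) choose m) = (fact (m + n) :: complex)"
  by (simp add: binomial_fact)

context complex_space
begin

text \<open>The scalar of the bracket is (j + p) \<lambda> - (i + p) \<mu>; the claim compares
  coefficients of \<lambda>^m \<mu>^n, the binomials coming from powers of \<lambda> +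
  \<mu>.\<close>

lemma commutator_coeff:
  fixes A :: "nat \<Rightarrow> 'm \<Rightarrow> 'm poly" and i j :: nat and v :: 'm
  assumes lin: "\<And>i k. lin (\<lambda>v. coeff (A i v) k)"
    and bracket: "\<And>l m. ((of_nat i + p) * (- (l + m)) + (of_nat i + of_nat j + 2 * p) * l) *s
          peval sc (A (i + j) v) (l + m)
        = (\<Sum>b\<le>degree (A j v). m ^ b *s peval sc (A i (coeff (A j v) b)) l)
          - (\<Sum>a\<le>degree (A i v). l ^ a *s peval sc (A j (coeff (A i v) a)) m)"
  shows "coeff (A i (coeff (A j v) n)) m - coeff (A j (coeff (A i v) m)) n =
    (if m = 0 then 0 else ((of_nat j + p) * of_nat ((m + n - 1) choose (m - 1))) *s coeff (A (i + j) v) (m + n - 1))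
    - (if n = 0 then 0 else ((of_nat i + p) * of_nat ((m + n - 1) choose m)) *s coeff (A (i + j) v) (m + n - 1))"
proof -
  define w where "w = coeff (A (i + j) v)"
  define di dj where "di = degree (A i v)" and "dj = degree (A j v)"
  \<comment> \<open>A common bound for all degrees involved, with m and n added to keep the wanted
    coefficient in range; \<open>?N\<close> leaves room for one extra factor x or y.\<close>
  define M where "M = degree (A (i + j) v) + di + dj + (\<Sum>b\<le>dj. degree (A i (coeff (A j v) b)))
    + (\<Sum>a\<le>di. degree (A j (coeff (A i v) a))) + m + n"
  let ?N = "Suc M"
  have zero: "coeff (A i 0) k = 0" for i k by (rule lin_zero[OF lin])
  have A0: "A i 0 = 0" for i by (rule poly_eqI) (simp add: zero)
  have deg_j: "degree (A i (coeff (A j v) b)) \<le> ?N" for b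
  proof (cases "b \<le> dj")
    case True
    then have "degree (A i (coeff (A j v) b)) \<le> (\<Sum>b\<le>dj. degree (A i (coeff (A j v) b)))"
      by (intro member_le_sum) auto
    then show ?thesis by (simp add: M_def)
  next
    case False
    then show ?thesis by (simp add: dj_def coeff_eq_0 A0)
  qed
  have deg_i: "degree (A j (coeff (A i v) a)) \<le> ?N" for a
  proof (cases "a \<le> di")
    case True
    then have "degree (A j (coeff (A i v) a)) \<le> (\<Sum>a\<le>di. degree (A j (coeff (A i v) a)))"
      by (intro member_le_sum) auto
    then show ?thesis by (simp add: M_def)
  next
    case False
    then show ?thesis by (simp add: di_def coeff_eq_0 A0)
  qed
  \<comment> \<open>\<open>f\<close> and \<open>g\<close> are the coefficients of x and of y times
    the action of L_(i+j) at x + y, hence the index shifts and the value 0 on an axis.\<close>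
  define f where "f a b = (if a = 0 then 0 else of_nat ((a + b - 1) choose (a - 1)) *s w (a + b - 1))" for a b
  define g where "g a b = (if b = 0 then 0 else of_nat ((a + b - 1) choose a) *s w (a + b - 1))" for a b
  define u where "u a b = (of_nat j + p) *s f a b - (of_nat i + p) *s g a b
    - coeff (A i (coeff (A j v) b)) a + coeff (A j (coeff (A i v) a)) b" for a b
  have "(\<Sum>a\<le>?N. \<Sum>b\<le>?N. (x ^ a * y ^ b) *s u a b) = 0" for x y
  proof -
    let ?S = "\<lambda>h. \<Sum>a\<le>?N. \<Sum>b\<le>?N. (x ^ a * y ^ b) *s h a b"
    define K where "K = degree (A (i + j) v)"
    have K: "K \<le> M" by (simp add: K_def M_def)
    have w0: "w k = 0" if "k > K" for k using that by (simp add: w_def K_def coeff_eq_0)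
    have T: "peval sc (A (i + j) v) (x + y) = (\<Sum>k\<le>K. (x + y) ^ k *s w k)"
      unfolding K_def w_def by (rule peval_eq) simp
    have F: "x *s peval sc (A (i + j) v) (x + y) = ?S f"
    proof -
      have "?S f = (\<Sum>a\<le>M. \<Sum>b\<le>?N. (x ^ Suc a * y ^ b) *s f (Suc a) b)"
        by (subst sum.atMost_Suc_shift) (simp add: f_def)
      also have "\<dots> = x *s (\<Sum>a\<le>M. \<Sum>b\<le>?N. (x ^ a * y ^ b * of_nat ((a + b) choose a)) *s w (a + b))"
        unfolding scale_sum_right by (intro sum.cong) (simp_all add: f_def mult.assoc)
      finally show ?thesis
        unfolding T using binomial_sum[of K w M ?N x y] w0 K by simp
    qed
    have G: "y *s peval sc (A (i + j) v) (x + y) = ?S g"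
    proof -
      have "?S g = (\<Sum>a\<le>?N. \<Sum>b\<le>M. (x ^ a * y ^ Suc b) *s g a (Suc b))"
      proof (rule sum.cong[OF refl])
        show "(\<Sum>b\<le>?N. (x ^ a * y ^ b) *s g a b) = (\<Sum>b\<le>M. (x ^ a * y ^ Suc b) *s g a (Suc b))" for a
          by (subst sum.atMost_Suc_shift) (simp add: g_def)
      qed
      also have "\<dots> = y *s (\<Sum>a\<le>?N. \<Sum>b\<le>M. (x ^ a * y ^ b * of_nat ((a + b) choose a)) *s w (a + b))"
        unfolding scale_sum_right by (intro sum.cong) (simp_all add: g_def ac_simps)
      finally show ?thesis
        unfolding T using binomial_sum[of K w ?N M x y] w0 K by simp
    qed
    have R1: "(\<Sum>b\<le>degree (A j v). y ^ b *s peval sc (A i (coeff (A j v) b)) x)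
        = ?S (\<lambda>a b. coeff (A i (coeff (A j v) b)) a)"
    proof -
      have "(\<Sum>b\<le>degree (A j v). y ^ b *s peval sc (A i (coeff (A j v) b)) x)
          = (\<Sum>b\<le>?N. y ^ b *s peval sc (A i (coeff (A j v) b)) x)"
        by (rule sum.mono_neutral_left) (auto simp: M_def dj_def coeff_eq_0 A0 peval_def)
      also have "\<dots> = (\<Sum>b\<le>?N. \<Sum>a\<le>?N. (x ^ a * y ^ b) *s coeff (A i (coeff (A j v) b)) a)"
        unfolding peval_eq[OF deg_j] scale_sum_right by (simp add: mult.commute)
      also have "\<dots> = ?S (\<lambda>a b. coeff (A i (coeff (A j v) b)) a)"
        by (rule sum.swap)
      finally show ?thesis .
    qed
    have R2: "(\<Sum>a\<le>degree (A i v). x ^ a *s peval sc (A j (coeff (A i v) a)) y)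
        = ?S (\<lambda>a b. coeff (A j (coeff (A i v) a)) b)"
    proof -
      have "(\<Sum>a\<le>degree (A i v). x ^ a *s peval sc (A j (coeff (A i v) a)) y)
          = (\<Sum>a\<le>?N. x ^ a *s peval sc (A j (coeff (A i v) a)) y)"
        by (rule sum.mono_neutral_left) (auto simp: M_def di_def coeff_eq_0 A0 peval_def)
      also have "\<dots> = ?S (\<lambda>a b. coeff (A j (coeff (A i v) a)) b)"
        unfolding peval_eq[OF deg_i] scale_sum_right by simp
      finally show ?thesis .
    qed
    have "((of_nat i + p) * (- (x + y)) + (of_nat i + of_nat j + 2 * p) * x) *s
        peval sc (A (i + j) v) (x + y) = (of_nat j + p) *s ?S f - (of_nat i + p) *s ?S g"
      unfolding F[symmetric] G[symmetric] by (simp add: algebra_simps)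
    then have "(of_nat j + p) *s ?S f - (of_nat i + p) *s ?S g
        - ?S (\<lambda>a b. coeff (A i (coeff (A j v) b)) a) + ?S (\<lambda>a b. coeff (A j (coeff (A i v) a)) b) = 0"
      using bracket[of x y] unfolding R1 R2 by simp
    moreover have "(x ^ a * y ^ b) *s u a b = (of_nat j + p) *s ((x ^ a * y ^ b) *s f a b)
        - (of_nat i + p) *s ((x ^ a * y ^ b) *s g a b)
        - (x ^ a * y ^ b) *s coeff (A i (coeff (A j v) b)) a
        + (x ^ a * y ^ b) *s coeff (A j (coeff (A i v) a)) b" for a b
      unfolding u_def by (simp add: scale_right_distrib scale_right_diff_distrib mult.commute)
    ultimately show ?thesis
      by (simp only: sum.distrib sum_subtractf scale_sum_right)
  qed
  then have "u m n = 0" by (rule vector_poly2_eq_0) (simp_all add: M_def)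
  then show ?thesis
    unfolding u_def f_def g_def w_def by (auto simp: algebra_simps)
qed

lemma block_module_of_conformal:
  assumes p: "p \<noteq> 0" and conf: "conformal_module p sc D act" and nt: "nontrivial_conf act"
    and fg: "finite_conf sc D" and irr: "irreducible_conf sc D act"
  shows "block_module sc p D (\<lambda>i n v. fact n *s coeff (act i v) n)"
proof -
  have D: "lin D" and A: "\<And>i k. lin (\<lambda>v. coeff (act i v) k)"
    and AD: "\<And>i v k. coeff (act i (D v)) k =
      D (coeff (act i v) k) + (if k = 0 then 0 else coeff (act i v) (k - 1))"
    using conf unfolding conformal_module_def by blast+
  have bracket: "((of_nat i + p) * (- (l + m)) + (of_nat i + of_nat j + 2 * p) * l) *s
          peval sc (act (i + j) v) (l + m)
        = (\<Sum>b\<le>degree (act j v). m ^ b *s peval sc (act i (coeff (act j v) b)) l)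
          - (\<Sum>a\<le>degree (act i v). l ^ a *s peval sc (act j (coeff (act i v) a)) m)" for i j v l m
    using conf unfolding conformal_module_def by blast
  let ?X = "\<lambda>i n v. fact n *s coeff (act i v) n"
  have A_scale: "coeff (act i (c *s v)) k = c *s coeff (act i v) k" for i k c v
    by (rule lin_scale[OF A])
  show ?thesis
  proof (intro block_module.intro block_module_axioms.intro complex_space_axioms p D)
    show "lin (?X i n)" for i n
      by (rule linI) (simp_all add: lin_add[OF A] A_scale scale_right_distrib mult.commute)
    show "?X i n (D v) = D (?X i n v) + of_nat n *s ?X i (n - 1) v" for i n v
      by (cases n) (simp_all add: AD lin_simps[OF D] scale_right_distrib)
    show "?X i m (?X j n v) = ?X j n (?X i m v) +
        (of_nat m * (of_nat j + p) - of_nat n * (of_nat i + p)) *s ?X (i + j) (m + n - 1) v" for i j m n v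
    proof -
      let ?w = "coeff (act (i + j) v) (m + n - 1)"
      \<comment> \<open>m! n! times the binomial of m + n - 1 over m - 1 equals m (m + n - 1)!,
        which clears the binomials.\<close>
      have 1: "(fact m * fact n) *s (if m = 0 then 0 else ((of_nat j + p) * of_nat ((m + n - 1) choose (m - 1))) *s ?w)
          = (of_nat m * (of_nat j + p)) *s fact (m + n - 1) *s ?w"
      proof (cases m)
        case (Suc k)
        have "fact m * fact n * ((of_nat j + p) * of_nat ((k + n) choose k)) =
            of_nat m * (of_nat j + p) * (fact k * fact n * of_nat ((k + n) choose k))"
          by (simp add: Suc del: of_nat_Suc)
        then show ?thesis unfolding fact_mult_binomial by (simp add: Suc del: of_nat_Suc fact_Suc)
      qed simp
      have 2: "(fact m * fact n) *s (if n = 0 then 0 else ((of_nat i + p) * of_nat ((m + n - 1) choose m)) *s ?w)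
          = (of_nat n * (of_nat i + p)) *s fact (m + n - 1) *s ?w"
      proof (cases n)
        case (Suc k)
        have "fact m * fact n * ((of_nat i + p) * of_nat ((m + k) choose m)) =
            of_nat n * (of_nat i + p) * (fact m * fact k * of_nat ((m + k) choose m))"
          by (simp add: Suc del: of_nat_Suc)
        then show ?thesis unfolding fact_mult_binomial by (simp add: Suc del: of_nat_Suc fact_Suc)
      qed simp
      have "?X i m (?X j n v) - ?X j n (?X i m v) =
          (fact m * fact n) *s (coeff (act i (coeff (act j v) n)) m - coeff (act j (coeff (act i v) m)) n)"
        by (simp add: A_scale scale_right_diff_distrib mult.commute)
      also have "\<dots> = (of_nat m * (of_nat j + p)) *s fact (m + n - 1) *s ?w
          - (of_nat n * (of_nat i + p)) *s fact (m + n - 1) *s ?w"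
        unfolding commutator_coeff[where A = act, OF A bracket] scale_right_diff_distrib 1 2 ..
      finally show ?thesis by (simp only: scale_left_diff_distrib diff_eq_eq add.commute)
    qed
    show "\<exists>N. \<forall>n\<ge>N. ?X i n v = 0" for i v
      by (rule exI[of _ "Suc (degree (act i v))"]) (simp add: coeff_eq_0)
    show "\<exists>S. finite S \<and> (\<forall>V. subspace V \<longrightarrow> S \<subseteq> V \<longrightarrow> (\<forall>v\<in>V. D v \<in> V) \<longrightarrow> V = UNIV)"
    proof -
      obtain S where S: "finite S" "\<forall>x. \<exists>f. x = (\<Sum>s\<in>S. polyD sc D (f s) s)"
        using fg unfolding finite_conf_def by blast
      have "V = UNIV" if V: "subspace V" "S \<subseteq> V" "\<forall>v\<in>V. D v \<in> V" for V
      proof -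
        have "x \<in> V" for x
        proof -
          obtain f where "x = (\<Sum>s\<in>S. polyD sc D (f s) s)" using S(2) by blast
          then show ?thesis using V by (auto intro!: subspace_sum polyD_in[OF D])
        qed
        then show ?thesis by blast
      qed
      then show ?thesis using S(1) by blast
    qed
    show "V = {0} \<or> V = UNIV"
      if V: "subspace V" "\<And>v. v \<in> V \<Longrightarrow> D v \<in> V" "\<And>i n v. v \<in> V \<Longrightarrow> ?X i n v \<in> V" for V
    proof -
      have "coeff (act i v) k \<in> V" if "v \<in> V" for i v k
        using subspace_scale[OF V(1) V(3)[OF that, of k i], of "1 / fact k"] by simp
      then have "conf_submodule sc D act V" using V by (simp add: conf_submodule_def)
      then show ?thesis using irr unfolding irreducible_conf_def by blast
    qed
    show "\<exists>i n v. ?X i n v \<noteq> 0"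
    proof -
      obtain i v where "act i v \<noteq> 0" using nt unfolding nontrivial_conf_def by blast
      then obtain n where "coeff (act i v) n \<noteq> 0" by (metis poly_eqI coeff_0)
      then show ?thesis by (intro exI[of _ i] exI[of _ n] exI[of _ v]) simp
    qed
  qed
qed

end

section \<open>Free modules of rank one\<close>

lemma shift_pCons: "shift (pCons a f) = [:[:a:]:] + [:[:0, 1:], 1:] * shift f"
  by (simp add: shift_def map_poly_pCons)

text \<open>Multiplication by \<partial> + \<lambda> on coefficients: the recursion obeyed by the
  action on \<partial> v, so that \<open>rank_one_iso\<close> can induct on f.\<close>

lemma coeff_shift_pCons_mult:
  "coeff (shift (pCons a f) * g) k = smult a (coeff g k) + pCons 0 (coeff (shift f * g) k)
    + (if k = 0 then 0 else coeff (shift f * g) (k - 1))"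
proof -
  have "shift (pCons a f) * g = smult [:a:] g + smult [:0, 1:] (shift f * g) + pCons 0 (shift f * g)"
    unfolding shift_pCons by (simp add: algebra_simps)
  then show ?thesis by (cases k) simp_all
qed

context complex_space
begin

text \<open>The natural map sends f to f(\<partial>) w; it is bijective by generation and freeness,
  and the isomorphism is its inverse. Sesquilinearity determines the action from its values
  \<open>g i\<close> on w.\<close>

lemma rank_one_iso:
  assumes D: "lin D" and A: "\<And>i k. lin (\<lambda>v. coeff (act i v) k)"
    and AD: "\<And>i v k. coeff (act i (D v)) k =
      D (coeff (act i v) k) + (if k = 0 then 0 else coeff (act i v) (k - 1))"
    and generated: "\<And>v. \<exists>f. v = polyD sc D f w"
    and free: "\<And>f. polyD sc D f w = 0 \<Longrightarrow> f = 0"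
    and act_w: "\<And>i k. coeff (act i w) k = polyD sc D (coeff (g i) k) w"
  shows "conf_iso sc D act smult rk1_D (\<lambda>i f. shift f * g i)"
proof -
  let ?\<psi> = "\<lambda>f. polyD sc D f w"
  have vs: "vector_space (smult :: complex \<Rightarrow> complex poly \<Rightarrow> complex poly)"
    by unfold_locales (auto simp: smult_add_right smult_add_left)
  have \<psi>_diff: "?\<psi> (f - h) = ?\<psi> f - ?\<psi> h" for f h
    using polyD_add[of D f "smult (- 1) h" w] polyD_smult[of D "- 1" h w] by simp
  have "inj ?\<psi>"
  proof (rule injI)
    fix f h assume "?\<psi> f = ?\<psi> h"
    then have "f - h = 0" by (intro free) (simp add: \<psi>_diff)
    then show "f = h" by simp
  qed
  moreover have "surj ?\<psi>" using generated unfolding surj_def by blast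
  ultimately have bij: "bij ?\<psi>" by (rule bijI)
  have \<psi>_pCons: "?\<psi> (pCons a f) = a *s w + D (?\<psi> f)" for a f
    by (rule polyD_pCons[OF D])
  have act_\<psi>: "coeff (act i (?\<psi> f)) k = ?\<psi> (coeff (shift f * g i) k)" for i f k
  proof (induction f arbitrary: k)
    case 0
    then show ?case using lin_zero[OF A] by (simp add: shift_def)
  next
    case (pCons a f)
    have "coeff (act i (?\<psi> (pCons a f))) k = a *s coeff (act i w) k + coeff (act i (D (?\<psi> f))) k"
      by (simp add: \<psi>_pCons lin_add[OF A] lin_scale[OF A])
    then show ?case
      by (simp add: AD pCons.IH act_w coeff_shift_pCons_mult polyD_add polyD_smult \<psi>_pCons)
  qed
  let ?\<phi> = "inv ?\<psi>"
  have \<psi>\<phi>: "?\<psi> (?\<phi> v) = v" for v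
    by (rule surj_f_inv_f[OF bij_is_surj[OF bij]])
  have \<phi>_eq: "?\<phi> v = f" if "?\<psi> f = v" for v f
    using that inv_f_f[OF bij_is_inj[OF bij], of f] by simp
  show ?thesis
    unfolding conf_iso_def
  proof (intro exI[of _ ?\<phi>] conjI allI)
    show "bij ?\<phi>" by (rule bij_imp_bij_inv[OF bij])
    show "Vector_Spaces.linear sc smult ?\<phi>"
      unfolding Vector_Spaces.linear_iff
      by (intro conjI allI vs vector_space_axioms \<phi>_eq) (simp_all add: polyD_add polyD_smult \<psi>\<phi>)
    show "?\<phi> (D v) = rk1_D (?\<phi> v)" for v
      by (rule \<phi>_eq) (simp add: rk1_D_def \<psi>_pCons \<psi>\<phi>)
    show "coeff (shift (?\<phi> v) * g i) k = ?\<phi> (coeff (act i v) k)" for i v k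
      by (rule \<phi>_eq[symmetric]) (simp add: act_\<psi>[symmetric] \<psi>\<phi>)
  qed
qed

end

theorem theorem5p1:
  fixes p :: complex
    and sc :: "complex \<Rightarrow> 'm::ab_group_add \<Rightarrow> 'm"
    and D :: "'m \<Rightarrow> 'm"
    and act :: "nat \<Rightarrow> 'm \<Rightarrow> 'm poly"
  assumes "p \<noteq> 0"
    and "conformal_module p sc D act"
    and "nontrivial_conf act"
    and "finite_conf sc D"
    and "irreducible_conf sc D act"
  shows "(p \<noteq> -1 \<longrightarrow>
            (\<exists>\<Delta> \<alpha>. \<Delta> \<noteq> 0 \<and> conf_iso sc D act smult rk1_D (M_act p \<Delta> \<alpha>)))
       \<and> (p = -1 \<longrightarrow>
            (\<exists>\<Delta> \<alpha> \<beta>. (\<Delta> \<noteq> 0 \<or> \<beta> \<noteq> 0) \<and> conf_iso sc D act smult rk1_D (M3_act \<Delta> \<alpha> \<beta>)))"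
proof -
  define X where "X = (\<lambda>i n v. sc (fact n) (coeff (act i v) n))"
  have "complex_space sc"
    using assms(2) by (simp add: conformal_module_def complex_space_def)
  then interpret block_module sc p D X
    unfolding X_def by (rule complex_space.block_module_of_conformal[OF _ assms])
  have A: "lin (\<lambda>v. coeff (act i v) k)" for i k
    using assms(2) unfolding conformal_module_def by blast
  have AD: "coeff (act i (D v)) k =
      D (coeff (act i v) k) + (if k = 0 then 0 else coeff (act i v) (k - 1))" for i v k
    using assms(2) unfolding conformal_module_def by blast
  have coeff_X: "coeff (act i v) k = sc (1 / fact k) (X i k v)" for i v k
    by (simp add: X_def)
  have free: "f = 0" if "polyD sc D f low = 0" for f
    using torsion_free[OF _ that] low_nonzero by blast
  obtain \<beta> where \<beta>: "\<And>v. X 1 0 v = sc \<beta> v" using X_1_scalar by blast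
  \<comment> \<open>Since \<open>X 0 1 low\<close> is p times \<open>wt low\<close> times
    \<open>low\<close>, the weight of \<open>low\<close> becomes \<Delta>.\<close>
  define g where "g i = (if i = 0 then [:[:p * alpha, p:], [:p * wt low:]:]
    else if i = 1 then [:[:\<beta>:]:] else 0)" for i :: nat
  have act_low: "coeff (act i low) k = polyD sc D (coeff (g i) k) low" for i k
  proof -
    consider "i = 0" "k = 0" | "i = 0" "k = 1" | "i = 0" "k \<ge> 2" | "i = 1" "k = 0" | "i = 1" "k \<ge> 1" | "i \<ge> 2"
      by linarith
    then show ?thesis
    proof cases
      case 1
      have "polyD sc D (smult p [:alpha, 1:]) low = sc p (dd low)"
        by (simp only: polyD_smult polyD_linear_alpha)
      then show ?thesis using 1 by (simp add: coeff_X X_0_0 g_def)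
    next
      case 2
      then show ?thesis using X_0_1[of low] euler_low by (simp add: coeff_X g_def)
    next
      case 3
      then show ?thesis
        using X_0_low_eq_0[of k] by (simp add: coeff_X g_def coeff_pCons split: nat.splits)
    next
      case 4
      then show ?thesis using \<beta> by (simp add: coeff_X g_def)
    next
      case 5
      then show ?thesis using X_1_low[of k] by (simp add: coeff_X g_def coeff_pCons split: nat.splits)
    next
      case 6
      then show ?thesis using X_higher_eq_0[of i] by (simp add: coeff_X g_def)
    qed
  qed
  have iso: "conf_iso sc D act smult rk1_D (\<lambda>i f. shift f * g i)"
    by (rule rank_one_iso[OF lin_D A AD low_generates free act_low])
  show ?thesis
  proof (intro conjI impI)
    assume p: "p \<noteq> - 1"
    then have "X 1 0 v = 0" for v by (simp add: X_higher_eq_0)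
    then have "wt low \<noteq> 0" "\<beta> = 0"
      using wt_low_nonzero \<beta>[of low] low_nonzero by auto
    moreover have "(\<lambda>i f. shift f * g i) = M_act p (wt low) alpha"
      using \<open>\<beta> = 0\<close> by (auto simp: fun_eq_iff M_act_def g_def)
    ultimately show "\<exists>\<Delta> \<alpha>. \<Delta> \<noteq> 0 \<and> conf_iso sc D act smult rk1_D (M_act p \<Delta> \<alpha>)"
      using iso by auto
  next
    assume p: "p = - 1"
    \<comment> \<open>If \<beta> = 0, then \<open>X 1 0\<close> vanishes identically and the
      argument against weight 0 applies.\<close>
    have "wt low \<noteq> 0 \<or> \<beta> \<noteq> 0" using wt_low_nonzero \<beta> by auto
    moreover have "(\<lambda>i f. shift f * g i) = M3_act (wt low) alpha \<beta>"
      using p by (auto simp: fun_eq_iff M3_act_def g_def)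
    ultimately show "\<exists>\<Delta> \<alpha> \<beta>. (\<Delta> \<noteq> 0 \<or> \<beta> \<noteq> 0) \<and> conf_iso sc D act smult rk1_D (M3_act \<Delta> \<alpha> \<beta>)"
      using iso by auto
  qed
qed

end
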